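(* Let $d\ge 2$. For every $k\in\mathbb{N}$ and every $d$-CNF formula $\gamma$ with $n$ variables, there exists $t\in\mathbb{N}$ such that in time $t\cdot\mathrm{poly}(n)$ one can obtain formulas $\gamma_1^i$ and $\gamma_2^i$ for every $i\in[t]$ with: 1. $\#(\gamma)=\sum_{i\in[t]}\big[\#(\gamma_1^i)-\#(\gamma_2^i)\big]$; 2. $t\le 2^{n/k}$; 3. all $\gamma_1^i,\gamma_2^i$ are $2$-CNF formulas in which each variable occurs at most $3$ times. The same statement holds with "$2$-CNF" replaced by "$2$-DNF" in item 3.
   Context: $[t]=\{1,\dots,t\}$. A $d$-CNF ($d$-DNF) is a formula in conjunctive (disjunctive) normal form with at most $d$ literals per clause (term). $\#(\varphi)$ is the number of satisfying assignments of $\varphi$ over its variables. *)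

theory Defs
  imports "HOL-Library.FuncSet" "HOL-Computational_Algebra.Polynomial"
begin

section \<open>Formulas in normal form\<close>

text \<open>A literal is a variable together with its sign. A formula carries the number \<open>n\<close> of
  its variables, which are \<open>0, \<dots>, n - 1\<close>, and its list of blocks: the clauses of a CNF, the
  terms of a DNF.\<close>

type_synonym literal = "nat \<times> bool"

datatype formula =
    is_CNF: CNF (nvars: nat) (blocks: "literal list list")
  | is_DNF: DNF (nvars: nat) (blocks: "literal list list")

fun sat :: "(nat \<Rightarrow> bool) \<Rightarrow> formula \<Rightarrow> bool" where
  "sat \<alpha> (CNF n bs) \<longleftrightarrow> (\<forall>b \<in> set bs. \<exists>(v, s) \<in> set b. \<alpha> v = s)"
| "sat \<alpha> (DNF n bs) \<longleftrightarrow> (\<exists>b \<in> set bs. \<forall>(v, s) \<in> set b. \<alpha> v = s)"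

definition num_sat :: "formula \<Rightarrow> nat" where
  "num_sat \<phi> = card {\<alpha> \<in> {..<nvars \<phi>} \<rightarrow>\<^sub>E (UNIV :: bool set). sat \<alpha> \<phi>}"

text \<open>Blocks are sets of literals and formulas are sets of blocks, listed without repetition.
  In particular, for fixed \<open>d\<close>, the length of a formula with at most \<open>d\<close> literals per block is
  polynomial in the number of its variables.\<close>

definition well_formed :: "formula \<Rightarrow> bool" where
  "well_formed \<phi> \<longleftrightarrow>
     (\<forall>b \<in> set (blocks \<phi>). distinct b \<and> (\<forall>(v, s) \<in> set b. v < nvars \<phi>)) \<and>
     distinct (map set (blocks \<phi>))"

definition d_CNF :: "nat \<Rightarrow> formula \<Rightarrow> bool" where
  "d_CNF d \<phi> \<longleftrightarrow> is_CNF \<phi> \<and> well_formed \<phi> \<and> (\<forall>b \<in> set (blocks \<phi>). length b \<le> d)"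

definition d_DNF :: "nat \<Rightarrow> formula \<Rightarrow> bool" where
  "d_DNF d \<phi> \<longleftrightarrow> is_DNF \<phi> \<and> well_formed \<phi> \<and> (\<forall>b \<in> set (blocks \<phi>). length b \<le> d)"

definition occurrences :: "nat \<Rightarrow> formula \<Rightarrow> nat" where
  "occurrences v \<phi> = length (filter (\<lambda>l. fst l = v) (concat (blocks \<phi>)))"


section \<open>Model of computation\<close>

text \<open>The WHILE language of Jones (Computability and Complexity from a Programming Perspective):
  imperative programs over binary trees. Every operation takes unit time, as on a pointer machine
  or RAM: trees are built, selected from and tested for being a leaf, never copied or compared.\<close>

datatype tree = Leaf | Node tree tree

fun left :: "tree \<Rightarrow> tree" where
  "left Leaf = Leaf"
| "left (Node x y) = x"

fun right :: "tree \<Rightarrow> tree" where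
  "right Leaf = Leaf"
| "right (Node x y) = y"

datatype expr = Var nat | ELeaf | ENode expr expr | ELeft expr | ERight expr

type_synonym state = "nat \<Rightarrow> tree"

primrec eval_exp :: "expr \<Rightarrow> state \<Rightarrow> tree" where
  "eval_exp (Var x) s = s x"
| "eval_exp ELeaf s = Leaf"
| "eval_exp (ENode e f) s = Node (eval_exp e s) (eval_exp f s)"
| "eval_exp (ELeft e) s = left (eval_exp e s)"
| "eval_exp (ERight e) s = right (eval_exp e s)"

primrec exp_time :: "expr \<Rightarrow> nat" where
  "exp_time (Var x) = 1"
| "exp_time ELeaf = 1"
| "exp_time (ENode e f) = 1 + exp_time e + exp_time f"
| "exp_time (ELeft e) = 1 + exp_time e"
| "exp_time (ERight e) = 1 + exp_time e"

datatype com =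
    Skip
  | Assign nat expr
  | Seq com com
  | If expr com com
  | While expr com

text \<open>\<open>exec c s T s'\<close>: started in state \<open>s\<close>, the command \<open>c\<close> halts in state \<open>s'\<close> after \<open>T\<close> time
  units. A condition is true iff its value is not \<open>Leaf\<close>.\<close>

inductive exec :: "com \<Rightarrow> state \<Rightarrow> nat \<Rightarrow> state \<Rightarrow> bool" where
  Skip: "exec Skip s 1 s"
| Assign: "exec (Assign x e) s (1 + exp_time e) (s(x := eval_exp e s))"
| Seq: "exec c s T s' \<Longrightarrow> exec c' s' T' s'' \<Longrightarrow> exec (Seq c c') s (T + T') s''"
| IfTrue: "eval_exp e s \<noteq> Leaf \<Longrightarrow> exec c s T s' \<Longrightarrow>
    exec (If e c c') s (1 + exp_time e + T) s'"
| IfFalse: "eval_exp e s = Leaf \<Longrightarrow> exec c' s T s' \<Longrightarrow>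
    exec (If e c c') s (1 + exp_time e + T) s'"
| WhileFalse: "eval_exp e s = Leaf \<Longrightarrow> exec (While e c) s (1 + exp_time e) s"
| WhileTrue: "eval_exp e s \<noteq> Leaf \<Longrightarrow> exec c s T s' \<Longrightarrow> exec (While e c) s' T' s'' \<Longrightarrow>
    exec (While e c) s (1 + exp_time e + T + T') s''"

inductive_cases exec_SkipE: "exec Skip s T s'"
inductive_cases exec_AssignE: "exec (Assign x e) s T s'"
inductive_cases exec_SeqE: "exec (Seq c c') s T s'"
inductive_cases exec_IfE: "exec (If e c c') s T s'"
inductive_cases exec_WhileE: "exec (While e c) s T s'"

lemma exec_deterministic:
  "exec c s T s' \<Longrightarrow> exec c s U u \<Longrightarrow> U = T \<and> u = s'"
proof (induction arbitrary: U u rule: exec.induct)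
  case (Skip s)
  then show ?case by (rule exec_SkipE) simp
next
  case (Assign x e s)
  then show ?case by (rule exec_AssignE) simp
next
  case (Seq c s T s' c' T' s'')
  from Seq.prems show ?case
    by (rule exec_SeqE) (auto dest!: Seq.IH)
next
  case (IfTrue e s c T s' c')
  from IfTrue.prems show ?case
    by (rule exec_IfE; use IfTrue.hyps(1) in \<open>auto dest!: IfTrue.IH\<close>)
next
  case (IfFalse e s c' T s' c)
  from IfFalse.prems show ?case
    by (rule exec_IfE; use IfFalse.hyps(1) in \<open>auto dest!: IfFalse.IH\<close>)
next
  case (WhileFalse e s c)
  from WhileFalse.prems show ?case
    by (rule exec_WhileE) (use WhileFalse.hyps in simp_all)
next
  case (WhileTrue e s c T s' T' s'')
  from WhileTrue.prems show ?case
    by (rule exec_WhileE; use WhileTrue.hyps(1) in \<open>auto dest!: WhileTrue.IH\<close>)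
qed

text \<open>Variable 0 holds the input and the output. The size of the output counts towards the time:
  since subtrees may be shared, a tree built in \<open>T\<close> steps can be exponentially larger than \<open>T\<close>, and
  such a tree has not been written out.\<close>

definition computes_within :: "com \<Rightarrow> tree \<Rightarrow> tree \<Rightarrow> nat \<Rightarrow> bool" where
  "computes_within c x y T \<longleftrightarrow>
     (\<exists>U s. exec c ((\<lambda>_. Leaf)(0 := x)) U s \<and> s 0 = y \<and> U + size y \<le> T)"


section \<open>Encoding of formulas as trees\<close>

primrec enc_list :: "('a \<Rightarrow> tree) \<Rightarrow> 'a list \<Rightarrow> tree" where
  "enc_list f [] = Leaf"
| "enc_list f (x # xs) = Node (f x) (enc_list f xs)"

text \<open>Numbers are encoded in unary.\<close>

primrec enc_nat :: "nat \<Rightarrow> tree" where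
  "enc_nat 0 = Leaf"
| "enc_nat (Suc n) = Node Leaf (enc_nat n)"

definition enc_bool :: "bool \<Rightarrow> tree" where
  "enc_bool b = (if b then Node Leaf Leaf else Leaf)"

definition enc_pair :: "('a \<Rightarrow> tree) \<Rightarrow> ('b \<Rightarrow> tree) \<Rightarrow> 'a \<times> 'b \<Rightarrow> tree" where
  "enc_pair f g p = Node (f (fst p)) (g (snd p))"

definition enc_formula :: "formula \<Rightarrow> tree" where
  "enc_formula \<phi> =
     Node (enc_bool (is_CNF \<phi>))
       (Node (enc_nat (nvars \<phi>)) (enc_list (enc_list (enc_pair enc_nat enc_bool)) (blocks \<phi>)))"

lemma inj_enc_list: "inj f \<Longrightarrow> inj (enc_list f)"
proof (rule injI)
  fix xs ys assume "inj f" "enc_list f xs = enc_list f ys"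
  then show "xs = ys"
  proof (induction xs arbitrary: ys)
    case Nil
    then show ?case by (cases ys) auto
  next
    case (Cons x xs)
    then show ?case by (cases ys) (auto simp: inj_eq)
  qed
qed

lemma inj_enc_nat: "inj enc_nat"
proof (rule injI)
  fix m n assume "enc_nat m = enc_nat n"
  then show "m = n"
  proof (induction m arbitrary: n)
    case 0
    then show ?case by (cases n) auto
  next
    case (Suc m)
    then show ?case by (cases n) auto
  qed
qed

lemma inj_enc_bool: "inj enc_bool"
  by (auto simp: inj_def enc_bool_def)

lemma inj_enc_pair: "inj f \<Longrightarrow> inj g \<Longrightarrow> inj (enc_pair f g)"
  by (auto simp: inj_def enc_pair_def)

lemma inj_enc_formula: "inj enc_formula"
proof (rule injI)
  fix \<phi> \<psi> assume *: "enc_formula \<phi> = enc_formula \<psi>"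
  have "enc_bool (is_CNF \<phi>) = enc_bool (is_CNF \<psi>)" and "enc_nat (nvars \<phi>) = enc_nat (nvars \<psi>)"
    and "enc_list (enc_list (enc_pair enc_nat enc_bool)) (blocks \<phi>) =
         enc_list (enc_list (enc_pair enc_nat enc_bool)) (blocks \<psi>)"
    using * unfolding enc_formula_def by simp_all
  then have "is_CNF \<phi> = is_CNF \<psi>" "nvars \<phi> = nvars \<psi>" "blocks \<phi> = blocks \<psi>"
    using injD[OF inj_enc_list[OF inj_enc_list[OF inj_enc_pair[OF inj_enc_nat inj_enc_bool]]]]
      injD[OF inj_enc_nat] injD[OF inj_enc_bool] by blast+
  then show "\<phi> = \<psi>" by (cases \<phi>; cases \<psi>) simp_all
qed

end

theory Submission
  imports Defs
begin

text \<open>A single difference of two formulas suffices for every \<open>k\<close>, because \<open>1 \<le> 2 powr (n / k)\<close>.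
  A sign bit runs through the clauses, and each clause contributes a gadget of binary clauses whose
  solutions, counted with the sign given by the new value of the bit, sum up to the old sign if the
  clause holds and cancel out otherwise. The number of models of \<open>\<gamma>\<close> is therefore the number of
  solutions with final sign \<open>+\<close> minus the number of those with final sign \<open>-\<close>. Replacing every
  variable by a cycle of implications between copies, one copy per clause, reduces the number of
  occurrences to three. For the DNF version both formulas are negated and exchanged; they have
  equally many variables, so the powers of two in the counts cancel.\<close>

section \<open>Polynomial time functions on trees\<close>

text \<open>For a fixed assignment of the input variables, a clause acts on the sign bit as a 2-by-2
  matrix of counts, which should fix the vector (1, -1) if the clause holds and annihilate it
  otherwise. The identity and the all-ones matrix J have these properties, but "the signs agree or
  this literal is false", written over both signs and the literal, takes clauses with three
  literals. Since J annihilates (1, -1), adding it to the identity in the first case and to J in the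
  second changes nothing, and it turns every entry into 1 + e with e in {0, 1}. Such an entry is the
  number of values of an auxiliary variable that may always be false and may be true only under
  certain literals, and those implications are binary. The four auxiliary variables belong to the
  four sign pairs, so at most one of them is free and the product of their counts is 1 + e for the
  actual pair. The matrices obtained have rows (2, 1), (1, 2) for a true clause and (2, 2), (2, 2)
  for a false one. The number of variables grows with the number of clauses, which for fixed
  \<open>d\<close> is polynomial in \<open>n\<close>.\<close>

definition poly_bounded :: "(nat \<Rightarrow> nat) \<Rightarrow> bool" where
  "poly_bounded h \<longleftrightarrow> (\<exists>p :: nat poly. \<forall>n. h n \<le> poly p n)"

text \<open>Natural coefficients make a polynomial monotone. This is why time bounds are taken in
  \<open>nat poly\<close>: an upper bound on an intermediate size can be substituted into the bound
  of the next program.\<close>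

lemma poly_nat_mono: "a \<le> b \<Longrightarrow> poly p a \<le> poly p b" for a b :: nat
  by (induction p) (auto intro: add_mono mult_mono)

lemma poly_bounded_poly: "poly_bounded (poly p)"
  by (auto simp: poly_bounded_def)

lemma poly_bounded_const: "poly_bounded (\<lambda>_. c)"
  unfolding poly_bounded_def by (rule exI[of _ "[:c:]"]) simp

lemma poly_bounded_id: "poly_bounded (\<lambda>n. n)"
  unfolding poly_bounded_def by (rule exI[of _ "[:0, 1:]"]) simp

lemma poly_bounded_add:
  assumes "poly_bounded f" "poly_bounded g"
  shows "poly_bounded (\<lambda>n. f n + g n)"
proof -
  from assms obtain p q where "\<And>n. f n \<le> poly p n" "\<And>n. g n \<le> poly q n"
    unfolding poly_bounded_def by blast
  then show ?thesis
    unfolding poly_bounded_def by (intro exI[of _ "p + q"]) (simp add: add_mono)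
qed

lemma poly_bounded_mult:
  assumes "poly_bounded f" "poly_bounded g"
  shows "poly_bounded (\<lambda>n. f n * g n)"
proof -
  from assms obtain p q where "\<And>n. f n \<le> poly p n" "\<And>n. g n \<le> poly q n"
    unfolding poly_bounded_def by blast
  then show ?thesis
    unfolding poly_bounded_def by (intro exI[of _ "p * q"]) (simp add: mult_mono)
qed

lemma poly_bounded_compose:
  assumes "poly_bounded f"
  shows "poly_bounded (\<lambda>n. poly p (f n))"
proof -
  from assms obtain q where "\<And>n. f n \<le> poly q n"
    unfolding poly_bounded_def by blast
  then show ?thesis
    unfolding poly_bounded_def
    by (intro exI[of _ "p \<circ>\<^sub>p q"]) (simp add: poly_pcompose poly_nat_mono)
qed

lemma poly_bounded_power: "poly_bounded f \<Longrightarrow> poly_bounded (\<lambda>n. f n ^ i)"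
  by (induction i) (auto intro: poly_bounded_const poly_bounded_mult)

lemma poly_bounded_sum:
  "(\<And>i. i \<in> I \<Longrightarrow> poly_bounded (f i)) \<Longrightarrow> poly_bounded (\<lambda>n. \<Sum>i\<in>I. f i n)"
  by (induction I rule: infinite_finite_induct) (auto intro: poly_bounded_const poly_bounded_add)

lemmas poly_bounded_intros = poly_bounded_const poly_bounded_id poly_bounded_poly poly_bounded_add
  poly_bounded_mult poly_bounded_compose

text \<open>The bound \<open>r\<close> on the modified variables lets programs be combined without renaming: whatever
  has to survive a call is kept above \<open>r\<close>.\<close>

definition computes :: "com \<Rightarrow> nat \<Rightarrow> nat poly \<Rightarrow> (tree \<Rightarrow> tree) \<Rightarrow> bool" where
  "computes c r p f \<longleftrightarrow> (\<forall>s. \<exists>T s'. exec c s T s' \<and> s' 0 = f (s 0) \<and> (\<forall>v\<ge>r. s' v = s v) \<and>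
     T + size (f (s 0)) \<le> poly p (size (s 0)))"

definition ptime :: "(tree \<Rightarrow> tree) \<Rightarrow> bool" where
  "ptime f \<longleftrightarrow> (\<exists>c r p. computes c r p f)"

lemma ptimeI:
  assumes "poly_bounded B"
    and "\<And>s. \<exists>T s'. exec c s T s' \<and> s' 0 = f (s 0) \<and> (\<forall>v\<ge>r. s' v = s v) \<and>
      T + size (f (s 0)) \<le> B (size (s 0))"
  shows "ptime f"
proof -
  obtain p where p: "\<And>n. B n \<le> poly p n"
    using assms(1) unfolding poly_bounded_def by blast
  have "computes c r p f"
    unfolding computes_def
  proof
    fix s :: state
    show "\<exists>T s'. exec c s T s' \<and> s' 0 = f (s 0) \<and> (\<forall>v\<ge>r. s' v = s v) \<and>
        T + size (f (s 0)) \<le> poly p (size (s 0))"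
      using assms(2)[of s] p[of "size (s 0)"] by (meson le_trans)
  qed
  then show ?thesis
    unfolding ptime_def by blast
qed

lemma computesE:
  assumes "computes c r p f" "size (s 0) \<le> N"
  obtains T s' where "exec c s T s'" "s' 0 = f (s 0)" "\<forall>v\<ge>r. s' v = s v"
    "T + size (f (s 0)) \<le> poly p N"
  using assms(1)[unfolded computes_def, rule_format, of s] poly_nat_mono[OF assms(2), of p]
  by (meson le_trans)

lemma size_left_le: "size (left x) \<le> size x"
  by (cases x) auto

lemma size_right_le: "size (right x) \<le> size x"
  by (cases x) auto

section \<open>Basic tree functions, composition and branching\<close>

lemma exec_AssignI: "T = 1 + exp_time e \<Longrightarrow> s' = s(x := eval_exp e s) \<Longrightarrow> exec (Assign x e) s T s'"
  by (simp only: exec.Assign)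

lemma ptime_expr:
  assumes "\<And>s. eval_exp e s = f (s 0)" "\<And>x. size (f x) \<le> size x + a"
  shows "ptime f"
proof (rule ptimeI)
  show "poly_bounded (\<lambda>n. 1 + exp_time e + (n + a))" by (intro poly_bounded_intros)
  show "\<exists>T s'. exec (Assign 0 e) s T s' \<and> s' 0 = f (s 0) \<and> (\<forall>v\<ge>1. s' v = s v) \<and>
      T + size (f (s 0)) \<le> 1 + exp_time e + (size (s 0) + a)" for s
    using exec.Assign[of 0 e s] assms
    by (intro exI[of _ "1 + exp_time e"] exI[of _ "s(0 := eval_exp e s)"] conjI) auto
qed

lemma ptime_id: "ptime (\<lambda>x. x)"
  by (rule ptime_expr[of "Var 0" _ 0]) auto

lemma ptime_Leaf: "ptime (\<lambda>_. Leaf)"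
  by (rule ptime_expr[of "ELeaf" _ 0]) auto

lemma ptime_left_base: "ptime left"
  by (rule ptime_expr[of "ELeft (Var 0)" _ 0]) (auto simp: size_left_le)

lemma ptime_right_base: "ptime right"
  by (rule ptime_expr[of "ERight (Var 0)" _ 0]) (auto simp: size_right_le)

lemma ptime_comp:
  assumes "ptime f" "ptime g"
  shows "ptime (\<lambda>x. f (g x))"
proof -
  obtain c r p where f: "computes c r p f"
    using assms(1) unfolding ptime_def by blast
  obtain c' r' p' where g: "computes c' r' p' g"
    using assms(2) unfolding ptime_def by blast
  show ?thesis
  proof (rule ptimeI)
    show "poly_bounded (\<lambda>n. poly p' n + poly p (poly p' n))" by (intro poly_bounded_intros)
    fix s :: state
    obtain T s' where 1: "exec c' s T s'" "s' 0 = g (s 0)" "\<forall>v\<ge>r'. s' v = s v"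
      "T + size (g (s 0)) \<le> poly p' (size (s 0))"
      by (rule computesE[OF g order.refl])
    then have "size (s' 0) \<le> poly p' (size (s 0))" by simp
    from computesE[where s = s', OF f this] obtain U t where 2: "exec c s' U t" "t 0 = f (s' 0)" "\<forall>v\<ge>r. t v = s' v"
      "U + size (f (s' 0)) \<le> poly p (poly p' (size (s 0)))"
      by blast
    have "exec (Seq c' c) s (T + U) t" using 1 2 by (auto intro: exec.Seq)
    then show "\<exists>T t. exec (Seq c' c) s T t \<and> t 0 = f (g (s 0)) \<and> (\<forall>v\<ge>max r r'. t v = s v) \<and>
        T + size (f (g (s 0))) \<le> poly p' (size (s 0)) + poly p (poly p' (size (s 0)))"
      using 1 2 by (intro exI[of _ "T + U"] exI[of _ t]) auto
  qed
qed

lemma ptime_left: "ptime f \<Longrightarrow> ptime (\<lambda>x. left (f x))"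
  by (rule ptime_comp[OF ptime_left_base])

lemma ptime_right: "ptime f \<Longrightarrow> ptime (\<lambda>x. right (f x))"
  by (rule ptime_comp[OF ptime_right_base])

lemma ptime_Node:
  assumes "ptime f" "ptime g"
  shows "ptime (\<lambda>x. Node (f x) (g x))"
proof -
  obtain c r p where f: "computes c r p f"
    using assms(1) unfolding ptime_def by blast
  obtain c' r' p' where g: "computes c' r' p' g"
    using assms(2) unfolding ptime_def by blast
  \<comment> \<open>\<open>R\<close> lies above the variables of both programs and differs from 0.
    It keeps the input for the second program, while \<open>Suc R\<close> keeps the first
    result.\<close>
  define R where "R = Suc (max r r')"
  define prog where "prog = Seq (Assign R (Var 0)) (Seq c (Seq (Assign (Suc R) (Var 0))
    (Seq (Assign 0 (Var R)) (Seq c' (Assign 0 (ENode (Var (Suc R)) (Var 0)))))))"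
  show ?thesis
  proof (rule ptimeI)
    show "poly_bounded (\<lambda>n. poly p n + poly p' n + 13)" by (intro poly_bounded_intros)
    fix s :: state
    define s1 where "s1 = s(R := s 0)"
    obtain T s2 where 1: "exec c s1 T s2" "s2 0 = f (s1 0)" "\<forall>v\<ge>r. s2 v = s1 v"
      "T + size (f (s1 0)) \<le> poly p (size (s1 0))"
      by (rule computesE[OF f order.refl])
    define s3 where "s3 = s2(Suc R := s2 0, 0 := s2 R)"
    obtain U s4 where 2: "exec c' s3 U s4" "s4 0 = g (s3 0)" "\<forall>v\<ge>r'. s4 v = s3 v"
      "U + size (g (s3 0)) \<le> poly p' (size (s3 0))"
      by (rule computesE[OF g order.refl])
    define s5 where "s5 = s4(0 := Node (s4 (Suc R)) (s4 0))"
    have "exec (Assign R (Var 0)) s 2 s1" "exec (Assign (Suc R) (Var 0)) s2 2 (s2(Suc R := s2 0))"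
      "exec (Assign 0 (Var R)) (s2(Suc R := s2 0)) 2 s3"
      "exec (Assign 0 (ENode (Var (Suc R)) (Var 0))) s4 4 s5"
      by (auto intro!: exec_AssignI simp: s1_def s3_def s5_def)
    then have "exec prog s (2 + (T + (2 + (2 + (U + 4))))) s5"
      unfolding prog_def using 1(1) 2(1) by (intro exec.Seq)
    moreover have "s1 0 = s 0" "s3 0 = s 0"
      using 1(3) by (simp_all add: s1_def s3_def R_def)
    moreover from this have "s5 0 = Node (f (s 0)) (g (s 0))"
      using 1(2) 2(2,3) by (simp add: s3_def s5_def R_def)
    moreover have "s5 v = s v" if "v \<ge> R + 2" for v
      using 1(3) 2(3) that by (simp add: s1_def s3_def s5_def R_def)
    ultimately show "\<exists>T t. exec prog s T t \<and> t 0 = Node (f (s 0)) (g (s 0)) \<and>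
        (\<forall>v\<ge>R + 2. t v = s v) \<and>
        T + size (Node (f (s 0)) (g (s 0))) \<le> poly p (size (s 0)) + poly p' (size (s 0)) + 13"
      using 1(4) 2(4)
      by (intro exI[of _ "2 + (T + (2 + (2 + (U + 4))))"] exI[of _ s5]) simp
  qed
qed

lemma ptime_if:
  assumes "ptime b" "ptime f" "ptime g"
  shows "ptime (\<lambda>x. if b x = Leaf then f x else g x)"
proof -
  obtain c0 r0 p0 where b: "computes c0 r0 p0 b"
    using assms(1) unfolding ptime_def by blast
  obtain c r p where f: "computes c r p f"
    using assms(2) unfolding ptime_def by blast
  obtain c' r' p' where g: "computes c' r' p' g"
    using assms(3) unfolding ptime_def by blast
  define R where "R = Suc (max r0 (max r r'))"
  \<comment> \<open>Values other than \<open>Leaf\<close> count as true, so the program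
    \<open>c'\<close> for \<open>g\<close> is the first branch of the conditional.\<close>
  define prog where "prog = Seq (Assign R (Var 0)) (Seq c0 (Seq (Assign (Suc R) (Var 0))
    (Seq (Assign 0 (Var R)) (If (Var (Suc R)) c' c))))"
  show ?thesis
  proof (rule ptimeI)
    show "poly_bounded (\<lambda>n. poly p0 n + poly p n + poly p' n + 8)" by (intro poly_bounded_intros)
    fix s :: state
    define s1 where "s1 = s(R := s 0)"
    obtain T s2 where 1: "exec c0 s1 T s2" "s2 0 = b (s1 0)" "\<forall>v\<ge>r0. s2 v = s1 v"
      "T + size (b (s1 0)) \<le> poly p0 (size (s1 0))"
      by (rule computesE[OF b order.refl])
    define s3 where "s3 = s2(Suc R := s2 0, 0 := s2 R)"
    have s3: "s3 0 = s 0" "s3 (Suc R) = b (s 0)" "\<And>v. v \<ge> R + 2 \<Longrightarrow> s3 v = s v"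
      using 1 by (auto simp: s1_def s3_def R_def)
    obtain U s4 where 2: "exec (If (Var (Suc R)) c' c) s3 U s4"
      "s4 0 = (if b (s 0) = Leaf then f (s 0) else g (s 0))" "\<forall>v\<ge>R + 2. s4 v = s3 v"
      "U + size (s4 0) \<le> poly p (size (s 0)) + poly p' (size (s 0)) + 2"
    proof (cases "b (s 0) = Leaf")
      case True
      obtain U s4 where "exec c s3 U s4" "s4 0 = f (s3 0)" "\<forall>v\<ge>r. s4 v = s3 v"
        "U + size (f (s3 0)) \<le> poly p (size (s3 0))"
        by (rule computesE[OF f order.refl])
      then show ?thesis
        using True s3 by (intro that[of "1 + exp_time (Var (Suc R)) + U" s4] exec.IfFalse)
          (auto simp: R_def)
    next
      case False
      obtain U s4 where "exec c' s3 U s4" "s4 0 = g (s3 0)" "\<forall>v\<ge>r'. s4 v = s3 v"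
        "U + size (g (s3 0)) \<le> poly p' (size (s3 0))"
        by (rule computesE[OF g order.refl])
      then show ?thesis
        using False s3 by (intro that[of "1 + exp_time (Var (Suc R)) + U" s4] exec.IfTrue)
          (auto simp: R_def)
    qed
    have "exec (Assign R (Var 0)) s 2 s1" "exec (Assign (Suc R) (Var 0)) s2 2 (s2(Suc R := s2 0))"
      "exec (Assign 0 (Var R)) (s2(Suc R := s2 0)) 2 s3"
      by (auto intro!: exec_AssignI simp: s1_def s3_def)
    then have "exec prog s (2 + (T + (2 + (2 + U)))) s4"
      unfolding prog_def using 1(1) 2(1) by (intro exec.Seq)
    moreover have "s1 0 = s 0" by (simp add: s1_def R_def)
    ultimately show "\<exists>T t. exec prog s T t \<and> t 0 = (if b (s 0) = Leaf then f (s 0) else g (s 0)) \<and>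
        (\<forall>v\<ge>R + 2. t v = s v) \<and>
        T + size (if b (s 0) = Leaf then f (s 0) else g (s 0)) \<le>
          poly p0 (size (s 0)) + poly p (size (s 0)) + poly p' (size (s 0)) + 8"
      using 1(4) 2(2-4) s3(3)
      by (intro exI[of _ "2 + (T + (2 + (2 + U)))"] exI[of _ s4]) simp
  qed
qed

section \<open>Loops over lists\<close>

text \<open>Trees are read as lists along the right spine. The function passed to \<open>concat_map\<close> receives
  the whole remaining list rather than its head, so its position (the length of the rest) is
  available as a unary number, and unary numbers themselves can be iterated over.\<close>

fun app :: "tree \<Rightarrow> tree \<Rightarrow> tree" where
  "app Leaf y = y"
| "app (Node a b) y = Node a (app b y)"

fun revapp :: "tree \<Rightarrow> tree \<Rightarrow> tree" where
  "revapp Leaf y = y"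
| "revapp (Node a b) y = revapp b (Node a y)"

fun concat_map :: "(tree \<Rightarrow> tree) \<Rightarrow> tree \<Rightarrow> tree" where
  "concat_map h Leaf = Leaf"
| "concat_map h (Node a b) = app (h (Node a b)) (concat_map h b)"

text \<open>The form that a loop can compute: results are pushed onto the accumulator
  \<open>y\<close>, since only the front of a list is accessible in unit time. The accumulator is
  therefore reversed, and a single \<open>revapp\<close> at the end restores the order.\<close>

fun rev_concat_map :: "(tree \<Rightarrow> tree) \<Rightarrow> tree \<Rightarrow> tree \<Rightarrow> tree" where
  "rev_concat_map h Leaf y = y"
| "rev_concat_map h (Node a b) y = rev_concat_map h b (revapp (h (Node a b)) y)"

lemma app_Leaf_right [simp]: "app x Leaf = x"
  by (induction x) auto

lemma app_assoc: "app (app x y) z = app x (app y z)"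
  by (induction x) auto

lemma size_revapp [simp]: "size (revapp x y) = size x + size y"
  by (induction x arbitrary: y) auto

lemma revapp_revapp: "revapp (revapp x y) z = revapp y (app x z)"
  by (induction x arbitrary: y) auto

lemma revapp_rev_concat_map:
  "revapp (rev_concat_map h l y) z = revapp y (app (concat_map h l) z)"
  by (induction l arbitrary: y) (auto simp: revapp_revapp app_assoc)

lemma exec_WhileTrueI:
  "eval_exp e s \<noteq> Leaf \<Longrightarrow> exec c s T s' \<Longrightarrow> exec (While e c) s' T' s'' \<Longrightarrow>
    U = 1 + exp_time e + T + T' \<Longrightarrow> exec (While e c) s U s''"
  by (metis exec.WhileTrue)

abbreviation rev_loop :: "nat \<Rightarrow> com" where
  "rev_loop R \<equiv> While (Var 0) (Seq (Assign R (ENode (ELeft (Var 0)) (Var R)))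
     (Assign 0 (ERight (Var 0))))"

text \<open>A round costs 2 for the test, 5 and 3 for the two assignments; the number of rounds is
  at most the size of the list, and the last, failing test adds 2. \<open>R\<close> must differ from
  0, which holds the list being consumed.\<close>

lemma exec_rev_loop:
  assumes "R > 0"
  shows "\<exists>T s'. exec (rev_loop R) s T s' \<and> s' R = revapp (s 0) (s R) \<and>
    (\<forall>v. v \<noteq> 0 \<longrightarrow> v \<noteq> R \<longrightarrow> s' v = s v) \<and> T \<le> 10 * size (s 0) + 2"
proof (induction "s 0" arbitrary: s)
  case Leaf
  then have "exec (rev_loop R) s (1 + exp_time (Var 0)) s"
    by (intro exec.WhileFalse) simp
  then show ?case using Leaf[symmetric] by fastforce
next
  case (Node a b)
  define s1 where "s1 = s(R := Node a (s R), 0 := b)"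
  have "b = s1 0" by (simp add: s1_def)
  from Node.hyps(2)[of s1, OF this] obtain T s' where s': "exec (rev_loop R) s1 T s'"
    "s' R = revapp (s1 0) (s1 R)" "\<forall>v. v \<noteq> 0 \<longrightarrow> v \<noteq> R \<longrightarrow> s' v = s1 v" "T \<le> 10 * size (s1 0) + 2"
    by blast
  have "exec (Assign R (ENode (ELeft (Var 0)) (Var R))) s 5 (s(R := Node a (s R)))"
    "exec (Assign 0 (ERight (Var 0))) (s(R := Node a (s R))) 3 s1"
    using assms Node.hyps(3)[symmetric] by (auto intro!: exec_AssignI simp: s1_def)
  from exec_WhileTrueI[OF _ exec.Seq[OF this] s'(1), of "10 + T"]
  have "exec (rev_loop R) s (10 + T) s'"
    using Node.hyps(3)[symmetric] by simp
  moreover have "s' R = revapp (s 0) (s R)" "\<forall>v. v \<noteq> 0 \<longrightarrow> v \<noteq> R \<longrightarrow> s' v = s v"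
    "10 + T \<le> 10 * size (s 0) + 2"
    using s' Node.hyps(3)[symmetric] assms by (auto simp: s1_def)
  ultimately show ?case by blast
qed

text \<open>The language has no closures, so the data on which the loop body depends travels in
  \<open>left y\<close>, next to the list in \<open>right y\<close>, and is paired with the
  remaining list before each call.\<close>

lemma ptime_concat_map_base:
  assumes "ptime h"
  shows "ptime (\<lambda>y. concat_map (\<lambda>s. h (Node (left y) s)) (right y))"
proof -
  obtain c r p where h: "computes c r p h"
    using assms unfolding ptime_def by blast
  define R where "R = Suc r"
  define body where "body = Seq (Assign 0 (ENode (Var R) (Var (R + 1)))) (Seq c
    (Seq (rev_loop (R + 2)) (Assign (R + 1) (ERight (Var (R + 1))))))"
  \<comment> \<open>\<open>N\<close> bounds the argument of every call, because the remaining list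
    only shrinks; so \<open>poly p N\<close> serves all rounds. A round takes 9 + T + U, where T
    plus the size of the result is at most \<open>poly p N\<close> and U is at most ten times that
    size plus 2; this gives the factor 10 and the constant 11.\<close>
  have loop: "\<exists>T s'. exec (While (Var (R + 1)) body) s T s' \<and>
      s' (R + 2) = rev_concat_map (\<lambda>z. h (Node (s R) z)) (s (R + 1)) (s (R + 2)) \<and>
      (\<forall>v \<ge> R + 3. s' v = s v) \<and> T \<le> size (s (R + 1)) * (10 * poly p N + 11) + 2 \<and>
      size (s' (R + 2)) \<le> size (s (R + 1)) * poly p N + size (s (R + 2))"
    if "1 + size (s R) + size (s (R + 1)) \<le> N" for s N
    using that
  proof (induction "s (R + 1)" arbitrary: s)
    case Leaf
    then have "exec (While (Var (R + 1)) body) s (1 + exp_time (Var (R + 1))) s"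
      by (intro exec.WhileFalse) simp
    then show ?case using Leaf(1)[symmetric] by fastforce
  next
    case (Node a b)
    note l = Node.hyps(3)[symmetric]
    define s1 where "s1 = s(0 := Node (s R) (s (R + 1)))"
    have "size (s1 0) \<le> N" using Node.prems by (simp add: s1_def)
    from computesE[where s = s1, OF h this] obtain T s2 where 2: "exec c s1 T s2" "s2 0 = h (s1 0)" "\<forall>v\<ge>r. s2 v = s1 v"
      "T + size (h (s1 0)) \<le> poly p N" by blast
    obtain U s3 where 3: "exec (rev_loop (R + 2)) s2 U s3" "s3 (R + 2) = revapp (s2 0) (s2 (R + 2))"
      "\<forall>v. v \<noteq> 0 \<longrightarrow> v \<noteq> R + 2 \<longrightarrow> s3 v = s2 v" "U \<le> 10 * size (s2 0) + 2"
      using exec_rev_loop[of "R + 2" s2] by auto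
    define s4 where "s4 = s3(R + 1 := b)"
    have s3R: "s3 (R + 1) = s (R + 1)" using 2(3) 3(3) by (simp add: s1_def R_def)
    have "exec (Assign 0 (ENode (Var R) (Var (R + 1)))) s 4 s1"
      "exec (Assign (R + 1) (ERight (Var (R + 1)))) s3 3 s4"
      using l s3R by (auto intro!: exec_AssignI simp: s1_def s4_def)
    then have step: "exec body s (4 + (T + (U + 3))) s4"
      unfolding body_def using 2(1) 3(1) by (intro exec.Seq)
    have s4: "s4 R = s R" "s4 (R + 1) = b" "s4 (R + 2) = revapp (h (Node (s R) (s (R + 1)))) (s (R + 2))"
      "\<And>v. v \<ge> R + 3 \<Longrightarrow> s4 v = s v"
      using 2(2,3) 3(2,3) by (auto simp: s4_def s1_def R_def)
    have "1 + size (s4 R) + size (s4 (R + 1)) \<le> N" using Node.prems l s4 by simp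
    from Node.hyps(2)[of s4, OF s4(2)[symmetric] this] obtain T' s' where
      s': "exec (While (Var (R + 1)) body) s4 T' s'"
        "s' (R + 2) = rev_concat_map (\<lambda>z. h (Node (s4 R) z)) (s4 (R + 1)) (s4 (R + 2))"
        "\<forall>v \<ge> R + 3. s' v = s4 v" "T' \<le> size (s4 (R + 1)) * (10 * poly p N + 11) + 2"
        "size (s' (R + 2)) \<le> size (s4 (R + 1)) * poly p N + size (s4 (R + 2))"
      by blast
    have hb: "T + size (h (Node (s R) (s (R + 1)))) \<le> poly p N"
      using 2(4) by (simp add: s1_def)
    have U: "U \<le> 10 * size (h (Node (s R) (s (R + 1)))) + 2"
      using 3(4) 2(2) by (simp add: s1_def)
    have "exec (While (Var (R + 1)) body) s (9 + T + U + T') s'"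
      using exec_WhileTrueI[OF _ step s'(1), of "9 + T + U + T'"] l by simp
    moreover have "s' (R + 2) = rev_concat_map (\<lambda>z. h (Node (s R) z)) (s (R + 1)) (s (R + 2))"
      using s'(2) by (simp only: s4 l rev_concat_map.simps)
    moreover have "\<forall>v \<ge> R + 3. s' v = s v"
      using s'(3) s4(4) by simp
    moreover have "9 + T + U + T' \<le> size (s (R + 1)) * (10 * poly p N + 11) + 2"
      using s'(4) hb U l s4(2) by (simp add: algebra_simps)
    moreover have "size (s' (R + 2)) \<le> size (s (R + 1)) * poly p N + size (s (R + 2))"
      using s'(5) hb l s4(2,3) by (simp add: algebra_simps)
    ultimately show ?case by blast
  qed
  define prog where "prog = Seq (Assign R (ELeft (Var 0))) (Seq (Assign (R + 1) (ERight (Var 0)))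
    (Seq (Assign (R + 2) ELeaf) (Seq (While (Var (R + 1)) body) (Seq (Assign 0 (Var (R + 2)))
    (Seq (Assign (R + 2) ELeaf) (Seq (rev_loop (R + 2)) (Assign 0 (Var (R + 2)))))))))"
  show ?thesis
  proof (rule ptimeI)
    let ?N = "\<lambda>n :: nat. 1 + n + n"
    \<comment> \<open>The first summand is the main loop. The factor 11 pays ten units per node for
      the final reversal and one for the output size; 18 collects 14 for the six assignments and 2
      for each of the two loops.\<close>
    show "poly_bounded (\<lambda>n. n * (10 * poly p (?N n) + 11) + 11 * (n * poly p (?N n)) + 18)" by (intro poly_bounded_intros)
    fix s :: state
    define n where "n = size (s 0)"
    define s1 where "s1 = s(R := left (s 0), R + 1 := right (s 0), R + 2 := Leaf)"
    have n: "size (s1 R) \<le> n" "size (s1 (R + 1)) \<le> n"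
      by (auto simp: s1_def n_def size_left_le size_right_le)
    then have "1 + size (s1 R) + size (s1 (R + 1)) \<le> ?N n" by simp
    from loop[of s1, OF this] obtain T s2 where 2: "exec (While (Var (R + 1)) body) s1 T s2"
      "s2 (R + 2) = rev_concat_map (\<lambda>z. h (Node (s1 R) z)) (s1 (R + 1)) (s1 (R + 2))"
      "\<forall>v \<ge> R + 3. s2 v = s1 v" "T \<le> size (s1 (R + 1)) * (10 * poly p (?N n) + 11) + 2"
      "size (s2 (R + 2)) \<le> size (s1 (R + 1)) * poly p (?N n) + size (s1 (R + 2))"
      by blast
    define s3 where "s3 = s2(0 := s2 (R + 2), R + 2 := Leaf)"
    obtain U s4 where 4: "exec (rev_loop (R + 2)) s3 U s4" "s4 (R + 2) = revapp (s3 0) (s3 (R + 2))"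
      "\<forall>v. v \<noteq> 0 \<longrightarrow> v \<noteq> R + 2 \<longrightarrow> s4 v = s3 v" "U \<le> 10 * size (s3 0) + 2"
      using exec_rev_loop[of "R + 2" s3] by auto
    define s5 where "s5 = s4(0 := s4 (R + 2))"
    have R: "R > 0" by (simp add: R_def)
    have "exec (Assign R (ELeft (Var 0))) s 3 (s(R := left (s 0)))"
      "exec (Assign (R + 1) (ERight (Var 0))) (s(R := left (s 0))) 3
        (s(R := left (s 0), R + 1 := right (s 0)))"
      "exec (Assign (R + 2) ELeaf) (s(R := left (s 0), R + 1 := right (s 0))) 2 s1"
      "exec (Assign 0 (Var (R + 2))) s2 2 (s2(0 := s2 (R + 2)))"
      "exec (Assign (R + 2) ELeaf) (s2(0 := s2 (R + 2))) 2 s3"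
      "exec (Assign 0 (Var (R + 2))) s4 2 s5"
      using R by (auto intro!: exec_AssignI simp: s1_def s3_def s5_def)
    then have ex: "exec prog s (3 + (3 + (2 + (T + (2 + (2 + (U + 2))))))) s5"
      unfolding prog_def using 2(1) 4(1) by (intro exec.Seq)
    have res: "s5 0 = concat_map (\<lambda>z. h (Node (left (s 0)) z)) (right (s 0))"
      using 2(2) 4(2) by (simp add: s5_def s3_def s1_def revapp_rev_concat_map)
    have s3: "size (s3 0) \<le> n * poly p (?N n)"
      using 2(5) n(2) by (auto simp: s3_def s1_def intro: order.trans mult_right_mono)
    have T: "T \<le> n * (10 * poly p (?N n) + 11) + 2"
      by (rule order.trans[OF 2(4)]) (use n(2) in \<open>auto intro: mult_right_mono\<close>)
    have s5: "size (s5 0) = size (s3 0)"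
      using 4(2) by (simp add: s5_def s3_def)
    have frame: "\<forall>v \<ge> R + 3. s5 v = s v"
      using 2(3) 4(3) by (auto simp: s5_def s3_def s1_def)
    have "3 + (3 + (2 + (T + (2 + (2 + (U + 2)))))) + size (s5 0)
        \<le> n * (10 * poly p (?N n) + 11) + 11 * (n * poly p (?N n)) + 18"
      using T 4(4) s3 s5 by linarith
    then show "\<exists>T t. exec prog s T t \<and>
        t 0 = concat_map (\<lambda>z. h (Node (left (s 0)) z)) (right (s 0)) \<and> (\<forall>v \<ge> R + 3. t v = s v) \<and>
        T + size (concat_map (\<lambda>z. h (Node (left (s 0)) z)) (right (s 0)))
        \<le> size (s 0) * (10 * poly p (?N (size (s 0))) + 11) + 11 * (size (s 0) * poly p (?N (size (s 0)))) + 18"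
      using ex res frame unfolding n_def
      by (intro exI[of _ "3 + (3 + (2 + (T + (2 + (2 + (U + 2))))))"] exI[of _ s5]) simp
  qed
qed

lemma ptime_concat_map:
  assumes "ptime (\<lambda>y. H (left y) (right y))" "ptime l"
  shows "ptime (\<lambda>x. concat_map (H x) (l x))"
  using ptime_comp[OF ptime_concat_map_base[OF assms(1)] ptime_Node[OF ptime_id assms(2)]] by simp

lemma ptime_const: "ptime (\<lambda>_. t)"
  by (induction t) (auto intro: ptime_Leaf ptime_Node)

text \<open>Appending is concatenation of a two-element list of lists, so it needs no program of its
  own.\<close>

lemma ptime_app:
  assumes "ptime f" "ptime g"
  shows "ptime (\<lambda>x. app (f x) (g x))"
proof -
  have "ptime (\<lambda>x. concat_map (\<lambda>s. left s) (Node (f x) (Node (g x) Leaf)))"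
    by (intro ptime_concat_map ptime_Node ptime_left ptime_right ptime_id ptime_Leaf assms)
  then show ?thesis by simp
qed

text \<open>Inside \<open>concat_map\<close> the input becomes a pair, so \<open>f\<close> and
  \<open>g\<close> would reappear composed with \<open>left\<close>. Reducing to the projections
  beforehand keeps the introduction rules directly applicable.\<close>

lemma ptime_curry:
  assumes "ptime (\<lambda>y. F (left y) (right y))" "ptime f" "ptime g"
  shows "ptime (\<lambda>x. F (f x) (g x))"
  using ptime_comp[OF assms(1) ptime_Node[OF assms(2,3)]] by simp

lemmas ptime_intros = ptime_const ptime_id ptime_left ptime_right ptime_Node ptime_app ptime_if
  ptime_concat_map

section \<open>List operations on encoded data\<close>

abbreviation enc_literal :: "literal \<Rightarrow> tree" where
  "enc_literal \<equiv> enc_pair enc_nat enc_bool"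

abbreviation enc_blocks :: "literal list list \<Rightarrow> tree" where
  "enc_blocks \<equiv> enc_list (enc_list enc_literal)"

lemma app_enc_nat: "app (enc_nat a) (enc_nat b) = enc_nat (a + b)"
  by (induction a) auto

lemma app_enc_list: "app (enc_list f xs) (enc_list f ys) = enc_list f (xs @ ys)"
  by (induction xs) auto

lemma concat_map_enc_list:
  "concat_map (\<lambda>s. h (left s)) (enc_list f xs) = enc_list g (concat (map F xs))"
  if "\<And>x. h (f x) = enc_list g (F x)"
  using that by (induction xs) (auto simp: app_enc_list)

text \<open>The proper suffixes of the unary number \<open>m\<close> are the numbers
  \<open>m - 1\<close> down to 0, met in this order; hence \<open>rev\<close>, here and in the
  definitions of the links.\<close>

lemma concat_map_enc_nat:
  "concat_map (\<lambda>s. h (right s)) (enc_nat m) = enc_list g (concat (map F (rev [0..<m])))"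
  if "\<And>i. h (enc_nat i) = enc_list g (F i)"
  using that by (induction m) (auto simp: app_enc_list)

lemma concat_map_const_enc_list:
  "concat_map (\<lambda>_. enc_nat k) (enc_list f xs) = enc_nat (length xs * k)"
  by (induction xs) (auto simp: app_enc_nat)

section \<open>The reduction as a tree program\<close>

fun neg_literal :: "literal \<Rightarrow> literal" where
  "neg_literal (v, b) = (v, \<not> b)"

text \<open>Variables \<open>k\<close> and \<open>k + 5\<close> are the sign bits \<open>t\<close> and \<open>s\<close> after and before the clause is
  processed. For given \<open>s\<close>, \<open>t\<close>, the remaining four variables can be set in
  \<open>1 + [s = t] + [s \<noteq> t \<and> all literals are false]\<close> ways, and the signed sum of this over \<open>t\<close> is
  \<open>(-1)^s\<close> if the clause is satisfied and \<open>0\<close> otherwise.\<close>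

definition gadget :: "nat \<Rightarrow> literal list \<Rightarrow> literal list list" where
  "gadget k c =
     [[(k + 1, False), (k + 5, False)], [(k + 1, False), (k, False)],
      [(k + 2, False), (k + 5, True)], [(k + 2, False), (k, False)],
      [(k + 3, False), (k + 5, True)], [(k + 3, False), (k, True)],
      [(k + 4, False), (k + 5, False)], [(k + 4, False), (k, True)]] @
     concat (map (\<lambda>l. [[(k + 2, False), neg_literal l], [(k + 4, False), neg_literal l]]) c)"

text \<open>A clause takes five new variables, four auxiliary ones and a sign bit, so the new sign
  of one gadget is the old sign of the next. Variable \<open>n\<close> is the final sign and
  \<open>n + length cs * 5\<close> the initial one.\<close>

primrec gadgets :: "nat \<Rightarrow> literal list list \<Rightarrow> literal list list" where
  "gadgets n [] = []"
| "gadgets n (c # cs) = gadget (n + length cs * 5) c @ gadgets n cs"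

text \<open>The unit clauses prescribe the final sign \<open>b\<close> and the initial sign
  \<open>False\<close>, where \<open>False\<close> stands for plus.\<close>

definition signed_blocks :: "nat \<Rightarrow> bool \<Rightarrow> literal list list \<Rightarrow> literal list list" where
  "signed_blocks n b cs = [(n, b)] # [(n + length cs * 5, False)] # gadgets n cs"

text \<open>The copies of variable \<open>v < V\<close> are \<open>j * V + v\<close> for \<open>j \<le> m\<close>, where \<open>m\<close> is the number of
  blocks; the block followed by \<open>j\<close> others uses the copies with index \<open>j + 1\<close>.\<close>

primrec copies :: "nat \<Rightarrow> literal list list \<Rightarrow> literal list list" where
  "copies V [] = []"
| "copies V (b # bs) = map (\<lambda>(v, s). (Suc (length bs) * V + v, s)) b # copies V bs"

text \<open>Adding \<open>V\<close> leads to the next copy of the same variable, so a single range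
  of \<open>i\<close> yields every implication from copy \<open>j + 1\<close> to copy
  \<open>j\<close>. The closing links lead from copy 0 back to copy \<open>m\<close>.\<close>

definition links :: "nat \<Rightarrow> nat \<Rightarrow> literal list list" where
  "links V m = map (\<lambda>i. [(i + V, False), (i, True)]) (rev [0..<m * V])"

definition closing_links :: "nat \<Rightarrow> nat \<Rightarrow> literal list list" where
  "closing_links V m = map (\<lambda>v. [(v, False), (m * V + v, True)]) (rev [0..<V])"

definition split_blocks :: "nat \<Rightarrow> literal list list \<Rightarrow> literal list list" where
  "split_blocks V bs = copies V bs @ links V (length bs) @ closing_links V (length bs)"

definition signed_formula :: "bool \<Rightarrow> formula \<Rightarrow> formula" where
  "signed_formula b \<gamma> =
    (let V = Suc (nvars \<gamma> + length (blocks \<gamma>) * 5);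
         bs = signed_blocks (nvars \<gamma>) b (blocks \<gamma>)
     in CNF (V + length bs * V) (split_blocks V bs))"

definition dual :: "formula \<Rightarrow> formula" where
  "dual \<phi> = DNF (nvars \<phi>) (map (map neg_literal) (blocks \<phi>))"

abbreviation tree_list :: "tree list \<Rightarrow> tree" where
  "tree_list \<equiv> enc_list (\<lambda>x. x)"

definition neg_tree :: "tree \<Rightarrow> tree" where
  "neg_tree l = Node (left l) (if right l = Leaf then Node Leaf Leaf else Leaf)"

definition add5_tree :: "tree \<Rightarrow> tree \<Rightarrow> tree" where
  "add5_tree N l = app N (concat_map (\<lambda>_. enc_nat 5) l)"

definition gadget_tree :: "tree \<Rightarrow> tree \<Rightarrow> tree" where
  "gadget_tree k c =
    (let a = Node (Node Leaf k) Leaf; b = Node (Node Leaf (left a)) Leaf;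
         c' = Node (Node Leaf (left b)) Leaf; d = Node (Node Leaf (left c')) Leaf;
         s = Node Leaf (left d)
     in app (tree_list (map tree_list [[a, Node s Leaf], [a, Node k Leaf],
         [b, Node s (Node Leaf Leaf)], [b, Node k Leaf],
         [c', Node s (Node Leaf Leaf)], [c', Node k (Node Leaf Leaf)],
         [d, Node s Leaf], [d, Node k (Node Leaf Leaf)]]))
       (concat_map (\<lambda>l. tree_list (map tree_list
         [[b, neg_tree (left l)], [d, neg_tree (left l)]])) c))"

text \<open>The offset of a gadget is determined by the number of clauses still to come, which is
  the length of \<open>right s\<close>; no counter is carried along.\<close>

definition gadgets_tree :: "tree \<Rightarrow> tree \<Rightarrow> tree" where
  "gadgets_tree N C = concat_map (\<lambda>s. gadget_tree (add5_tree N (right s)) (left s)) C"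

definition signed_blocks_tree :: "tree \<Rightarrow> tree \<Rightarrow> tree \<Rightarrow> tree" where
  "signed_blocks_tree B N C =
     Node (tree_list [Node N B]) (Node (tree_list [Node (add5_tree N C) Leaf]) (gadgets_tree N C))"

definition mult_tree :: "tree \<Rightarrow> tree \<Rightarrow> tree" where
  "mult_tree V l = concat_map (\<lambda>_. V) l"

text \<open>The copy index of a block is one more than the number of blocks after it, hence the
  length of the whole suffix \<open>s\<close>, head included. \<open>mult_tree\<close> multiplies it
  by \<open>V\<close> in unary.\<close>

definition split_blocks_tree :: "tree \<Rightarrow> tree \<Rightarrow> tree" where
  "split_blocks_tree V bs =
     app (concat_map (\<lambda>s. tree_list [concat_map (\<lambda>l. tree_list
           [Node (app (mult_tree V s) (left (left l))) (right (left l))]) (left s)]) bs)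
     (app (concat_map (\<lambda>s. tree_list [tree_list [Node (app (right s) V) Leaf,
             Node (right s) (Node Leaf Leaf)]]) (mult_tree V bs))
       (concat_map (\<lambda>s. tree_list [tree_list [Node (right s) Leaf,
             Node (app (mult_tree V bs) (right s)) (Node Leaf Leaf)]]) V))"

definition neg_blocks_tree :: "tree \<Rightarrow> tree" where
  "neg_blocks_tree bs =
     concat_map (\<lambda>s. tree_list [concat_map (\<lambda>l. tree_list [neg_tree (left l)]) (left s)]) bs"

definition signed_formula_tree :: "tree \<Rightarrow> tree \<Rightarrow> tree" where
  "signed_formula_tree B x =
    (let V = Node Leaf (add5_tree (left (right x)) (right (right x)));
         bs = signed_blocks_tree B (left (right x)) (right (right x))
     in Node (Node Leaf Leaf) (Node (app V (mult_tree V bs)) (split_blocks_tree V bs)))"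

definition dual_tree :: "tree \<Rightarrow> tree" where
  "dual_tree x = Node Leaf (Node (left (right x)) (neg_blocks_tree (right (right x))))"

section \<open>Polynomial time of the tree programs\<close>

lemma ptime_neg_tree: "ptime f \<Longrightarrow> ptime (\<lambda>x. neg_tree (f x))"
  unfolding neg_tree_def by (intro ptime_intros)

lemma ptime_add5_tree: "ptime f \<Longrightarrow> ptime g \<Longrightarrow> ptime (\<lambda>x. add5_tree (f x) (g x))"
  unfolding add5_tree_def by (intro ptime_intros)

lemma ptime_gadget_tree: "ptime f \<Longrightarrow> ptime g \<Longrightarrow> ptime (\<lambda>x. gadget_tree (f x) (g x))"
  by (rule ptime_curry) (auto simp: gadget_tree_def Let_def intro!: ptime_intros ptime_neg_tree)

lemma ptime_gadgets_tree: "ptime f \<Longrightarrow> ptime g \<Longrightarrow> ptime (\<lambda>x. gadgets_tree (f x) (g x))"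
  by (rule ptime_curry)
    (auto simp: gadgets_tree_def intro!: ptime_intros ptime_gadget_tree ptime_add5_tree)

lemma ptime_signed_blocks_tree:
  "ptime f \<Longrightarrow> ptime g \<Longrightarrow> ptime (\<lambda>x. signed_blocks_tree B (f x) (g x))"
  by (auto simp: signed_blocks_tree_def intro!: ptime_intros ptime_add5_tree ptime_gadgets_tree)

lemma ptime_mult_tree: "ptime f \<Longrightarrow> ptime g \<Longrightarrow> ptime (\<lambda>x. mult_tree (f x) (g x))"
  by (rule ptime_curry) (auto simp: mult_tree_def intro!: ptime_intros)

lemma ptime_split_blocks_tree: "ptime f \<Longrightarrow> ptime g \<Longrightarrow> ptime (\<lambda>x. split_blocks_tree (f x) (g x))"
  by (rule ptime_curry) (auto simp: split_blocks_tree_def intro!: ptime_intros ptime_mult_tree)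

lemma ptime_neg_blocks_tree: "ptime f \<Longrightarrow> ptime (\<lambda>x. neg_blocks_tree (f x))"
  by (auto simp: neg_blocks_tree_def intro!: ptime_intros ptime_neg_tree)

lemma ptime_signed_formula_tree: "ptime (signed_formula_tree B)"
  by (auto simp: signed_formula_tree_def[abs_def] Let_def intro!: ptime_intros ptime_mult_tree
      ptime_add5_tree ptime_signed_blocks_tree ptime_split_blocks_tree)

lemma ptime_dual_tree: "ptime dual_tree"
  by (auto simp: dual_tree_def[abs_def] intro!: ptime_intros ptime_neg_blocks_tree)

section \<open>Agreement of the tree programs with the operations on formulas\<close>

lemma enc_literal_Pair [simp]:
  "enc_literal (v, True) = Node (enc_nat v) (Node Leaf Leaf)"
  "enc_literal (v, False) = Node (enc_nat v) Leaf"
  by (simp_all add: enc_pair_def enc_bool_def)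

lemma neg_tree_enc: "neg_tree (enc_literal l) = enc_literal (neg_literal l)"
  by (cases l) (auto simp: neg_tree_def enc_pair_def enc_bool_def)

lemma add5_tree_enc: "add5_tree (enc_nat n) (enc_list f xs) = enc_nat (n + length xs * 5)"
  unfolding add5_tree_def concat_map_const_enc_list app_enc_nat ..

lemma gadget_tree_enc: "gadget_tree (enc_nat k) (enc_list enc_literal c) = enc_blocks (gadget k c)"
proof -
  have "concat_map (\<lambda>l. tree_list (map tree_list
         [[Node (enc_nat (k + 2)) Leaf, neg_tree (left l)],
          [Node (enc_nat (k + 4)) Leaf, neg_tree (left l)]])) (enc_list enc_literal c) =
    enc_blocks (concat (map (\<lambda>l. [[(k + 2, False), neg_literal l], [(k + 4, False), neg_literal l]]) c))"
    by (rule concat_map_enc_list) (simp add: neg_tree_enc)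
  then show ?thesis
    unfolding gadget_def gadget_tree_def Let_def app_enc_list[symmetric]
    by (simp add: numeral_eq_Suc)
qed

lemma gadgets_tree_enc: "gadgets_tree (enc_nat n) (enc_blocks cs) = enc_blocks (gadgets n cs)"
  by (induction cs) (auto simp: gadgets_tree_def add5_tree_enc gadget_tree_enc app_enc_list)

lemma signed_blocks_tree_enc:
  "signed_blocks_tree (enc_bool b) (enc_nat n) (enc_blocks cs) = enc_blocks (signed_blocks n b cs)"
  by (auto simp: signed_blocks_tree_def signed_blocks_def add5_tree_enc gadgets_tree_enc enc_pair_def
      enc_bool_def)

lemma mult_tree_enc: "mult_tree (enc_nat V) (enc_list f xs) = enc_nat (length xs * V)"
  by (simp add: mult_tree_def concat_map_const_enc_list)

lemma copies_tree_enc: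
  "concat_map (\<lambda>s. tree_list [concat_map (\<lambda>l. tree_list
      [Node (app (mult_tree (enc_nat V) s) (left (left l))) (right (left l))]) (left s)])
    (enc_blocks bs) = enc_blocks (copies V bs)"
proof (induction bs)
  case (Cons b bs)
  have "concat_map (\<lambda>l. tree_list [Node (app (mult_tree (enc_nat V) (enc_blocks (b # bs)))
      (left (left l))) (right (left l))]) (enc_list enc_literal b) =
    enc_list enc_literal (concat (map (\<lambda>(v, s). [(Suc (length bs) * V + v, s)]) b))"
    unfolding mult_tree_enc
    by (rule concat_map_enc_list) (auto simp: enc_pair_def app_enc_nat)
  moreover have "concat (map (\<lambda>(v, s). [(Suc (length bs) * V + v, s)]) b) =
      map (\<lambda>(v, s). (Suc (length bs) * V + v, s)) b"
    by (induction b) auto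
  ultimately show ?case using Cons by simp
qed simp

lemma split_blocks_tree_enc:
  "split_blocks_tree (enc_nat V) (enc_blocks bs) = enc_blocks (split_blocks V bs)"
proof -
  have "concat_map (\<lambda>s. tree_list [tree_list [Node (app (right s) (enc_nat V)) Leaf,
      Node (right s) (Node Leaf Leaf)]]) (enc_nat (length bs * V)) =
    enc_blocks (concat (map (\<lambda>i. [[(i + V, False), (i, True)]]) (rev [0..<length bs * V])))"
    by (rule concat_map_enc_nat) (simp add: app_enc_nat)
  moreover have "concat_map (\<lambda>s. tree_list [tree_list [Node (right s) Leaf,
      Node (app (enc_nat (length bs * V)) (right s)) (Node Leaf Leaf)]]) (enc_nat V) =
    enc_blocks (concat (map (\<lambda>v. [[(v, False), (length bs * V + v, True)]]) (rev [0..<V])))"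
    by (rule concat_map_enc_nat) (simp add: app_enc_nat)
  ultimately show ?thesis
    unfolding split_blocks_tree_def split_blocks_def copies_tree_enc mult_tree_enc
    by (simp add: app_enc_list links_def closing_links_def)
qed

lemma signed_formula_tree_enc:
  "signed_formula_tree (enc_bool b) (enc_formula \<gamma>) = enc_formula (signed_formula b \<gamma>)"
proof -
  have "Node Leaf (enc_nat m) = enc_nat (Suc m)" for m by simp
  then show ?thesis
    unfolding signed_formula_tree_def signed_formula_def enc_formula_def Let_def
    by (simp only: left.simps right.simps add5_tree_enc signed_blocks_tree_enc mult_tree_enc
        split_blocks_tree_enc app_enc_nat) (simp add: enc_bool_def)
qed

lemma dual_tree_enc: "dual_tree (enc_formula \<phi>) = enc_formula (dual \<phi>)"
proof -
  have "concat_map (\<lambda>l. tree_list [neg_tree (left l)]) (enc_list enc_literal b) =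
      enc_list enc_literal (concat (map (\<lambda>l. [neg_literal l]) b))" for b
    by (rule concat_map_enc_list) (simp add: neg_tree_enc)
  then have "concat_map (\<lambda>s. tree_list [concat_map (\<lambda>l. tree_list [neg_tree (left l)]) (left s)])
      (enc_blocks bs) = enc_blocks (concat (map (\<lambda>b. [concat (map (\<lambda>l. [neg_literal l]) b)]) bs))" for bs
    by (intro concat_map_enc_list) simp
  then show ?thesis
    by (simp add: dual_tree_def enc_formula_def dual_def neg_blocks_tree_def enc_bool_def)
qed

section \<open>Running time\<close>

lemma size_enc_nat [simp]: "size (enc_nat n) = n"
  by (induction n) auto

lemma size_enc_list_le:
  assumes "\<And>x. x \<in> set xs \<Longrightarrow> size (f x) \<le> B"
  shows "size (enc_list f xs) \<le> length xs * (B + 1)"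
  using assms
proof (induction xs)
  case (Cons x xs)
  then have "size (f x) \<le> B" "size (enc_list f xs) \<le> length xs * (B + 1)" by simp_all
  then show ?case by simp
qed simp

text \<open>Blocks that are distinct as sets are distinct as lists, and there are
  \<open>(2 * n) ^ i\<close> lists of length \<open>i\<close> over the literals of \<open>n\<close>
  variables. This turns a time bound in the input length into one in the number of
  variables.\<close>

lemma num_blocks_le:
  assumes "d_CNF d \<gamma>"
  shows "length (blocks \<gamma>) \<le> (\<Sum>i\<le>d. (2 * nvars \<gamma>) ^ i)"
proof -
  let ?A = "{..<nvars \<gamma>} \<times> (UNIV :: bool set)"
  have "distinct (map set (blocks \<gamma>))"
    and *: "\<And>b v s. b \<in> set (blocks \<gamma>) \<Longrightarrow> (v, s) \<in> set b \<Longrightarrow> v < nvars \<gamma>"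
    and "\<And>b. b \<in> set (blocks \<gamma>) \<Longrightarrow> length b \<le> d"
    using assms by (auto simp: d_CNF_def well_formed_def)
  then have "set (blocks \<gamma>) \<subseteq> {b. set b \<subseteq> ?A \<and> length b \<le> d}" by auto
  then have "card (set (blocks \<gamma>)) \<le> card {b. set b \<subseteq> ?A \<and> length b \<le> d}"
    by (intro card_mono finite_lists_length_le) auto
  also have "\<dots> = (\<Sum>i\<le>d. (2 * nvars \<gamma>) ^ i)"
    by (subst card_lists_length_le) (auto simp: mult.commute)
  finally show ?thesis
    using \<open>distinct (map set (blocks \<gamma>))\<close> by (simp add: distinct_map distinct_card)
qed

lemma size_enc_formula_le:
  assumes "d_CNF d \<gamma>"
  shows "size (enc_formula \<gamma>) \<le>
    3 + nvars \<gamma> + (\<Sum>i\<le>d. (2 * nvars \<gamma>) ^ i) * (d * (nvars \<gamma> + 3) + 1)"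
proof -
  have "size (enc_list enc_literal b) \<le> d * (nvars \<gamma> + 3)" if b: "b \<in> set (blocks \<gamma>)" for b
  proof -
    have "size (enc_literal l) \<le> nvars \<gamma> + 2" if "l \<in> set b" for l
    proof -
      have "fst l < nvars \<gamma>"
        using assms b that by (cases l) (auto simp: d_CNF_def well_formed_def)
      then show ?thesis by (simp add: enc_pair_def enc_bool_def)
    qed
    then have "size (enc_list enc_literal b) \<le> length b * (nvars \<gamma> + 2 + 1)"
      by (rule size_enc_list_le)
    also have "\<dots> \<le> d * (nvars \<gamma> + 2 + 1)"
      using assms b by (intro mult_le_mono1) (simp add: d_CNF_def)
    finally show ?thesis by (simp add: algebra_simps)
  qed
  then have "size (enc_blocks (blocks \<gamma>)) \<le> length (blocks \<gamma>) * (d * (nvars \<gamma> + 3) + 1)"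
    by (rule size_enc_list_le)
  also have "\<dots> \<le> (\<Sum>i\<le>d. (2 * nvars \<gamma>) ^ i) * (d * (nvars \<gamma> + 3) + 1)"
    using num_blocks_le[OF assms] by (rule mult_right_mono) simp
  finally show ?thesis
    by (simp add: enc_formula_def enc_bool_def)
qed

text \<open>The program starts by discarding \<open>k\<close>, at cost 3, so neither it nor its
  polynomial depends on \<open>k\<close>.\<close>

lemma ptime_imp_computes_within:
  assumes "ptime F"
  shows "\<exists>prog p. \<forall>k \<gamma>. d_CNF d \<gamma> \<longrightarrow>
    computes_within prog (enc_pair enc_nat enc_formula (k, \<gamma>)) (F (enc_formula \<gamma>)) (poly p (nvars \<gamma>))"
proof -
  obtain c r q where F: "computes c r q F"
    using assms unfolding ptime_def by blast
  let ?B = "\<lambda>n. 3 + poly q (3 + n + (\<Sum>i\<le>d. (2 * n) ^ i) * (d * (n + 3) + 1))"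
  have "poly_bounded ?B"
    by (intro poly_bounded_intros poly_bounded_sum poly_bounded_power)
  then obtain p where p: "\<And>n. ?B n \<le> poly p n"
    unfolding poly_bounded_def by blast
  have "computes_within (Seq (Assign 0 (ERight (Var 0))) c) (enc_pair enc_nat enc_formula (k, \<gamma>))
      (F (enc_formula \<gamma>)) (poly p (nvars \<gamma>))" if "d_CNF d \<gamma>" for k \<gamma>
  proof -
    define s :: state where "s = (\<lambda>_. Leaf)(0 := enc_formula \<gamma>)"
    have s: "s 0 = enc_formula \<gamma>" by (simp add: s_def)
    have size: "size (s 0) \<le>
        3 + nvars \<gamma> + (\<Sum>i\<le>d. (2 * nvars \<gamma>) ^ i) * (d * (nvars \<gamma> + 3) + 1)"
      using size_enc_formula_le[OF that] s by simp
    obtain T s' where T: "exec c s T s'" "s' 0 = F (s 0)"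
      "T + size (F (s 0)) \<le> poly q (3 + nvars \<gamma> + (\<Sum>i\<le>d. (2 * nvars \<gamma>) ^ i) * (d * (nvars \<gamma> + 3) + 1))"
      by (rule computesE[where s = s, OF F size])
    have "exec (Assign 0 (ERight (Var 0)))
        ((\<lambda>_. Leaf)(0 := enc_pair enc_nat enc_formula (k, \<gamma>))) 3 s"
      by (rule exec_AssignI) (simp_all add: enc_pair_def s_def)
    from exec.Seq[OF this T(1)] show ?thesis
      unfolding computes_within_def using T(2,3) p[of "nvars \<gamma>"] s
      by (intro exI[of _ "3 + T"] exI[of _ s']) simp
  qed
  then show ?thesis by blast
qed

section \<open>Counting solutions\<close>

abbreviation assignments :: "nat \<Rightarrow> (nat \<Rightarrow> bool) set" where
  "assignments n \<equiv> {..<n} \<rightarrow>\<^sub>E UNIV"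

definition sat_blocks :: "(nat \<Rightarrow> bool) \<Rightarrow> literal list list \<Rightarrow> bool" where
  "sat_blocks \<alpha> bs \<longleftrightarrow> (\<forall>b \<in> set bs. \<exists>l \<in> set b. \<alpha> (fst l) = snd l)"

definition bounded_blocks :: "nat \<Rightarrow> literal list list \<Rightarrow> bool" where
  "bounded_blocks n bs \<longleftrightarrow> (\<forall>b \<in> set bs. \<forall>l \<in> set b. fst l < n)"

lemma sat_blocks_simps [simp]:
  "sat_blocks \<alpha> []"
  "sat_blocks \<alpha> (b # bs) \<longleftrightarrow> (\<exists>l \<in> set b. \<alpha> (fst l) = snd l) \<and> sat_blocks \<alpha> bs"
  "sat_blocks \<alpha> (bs @ bs') \<longleftrightarrow> sat_blocks \<alpha> bs \<and> sat_blocks \<alpha> bs'"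
  by (auto simp: sat_blocks_def)

lemma bounded_blocks_simps [simp]:
  "bounded_blocks n []"
  "bounded_blocks n (b # bs) \<longleftrightarrow> (\<forall>l \<in> set b. fst l < n) \<and> bounded_blocks n bs"
  "bounded_blocks n (bs @ bs') \<longleftrightarrow> bounded_blocks n bs \<and> bounded_blocks n bs'"
  by (auto simp: bounded_blocks_def)

lemma sat_blocks_cong:
  "bounded_blocks n bs \<Longrightarrow> (\<And>v. v < n \<Longrightarrow> \<alpha> v = \<beta> v) \<Longrightarrow> sat_blocks \<alpha> bs = sat_blocks \<beta> bs"
  by (simp add: sat_blocks_def bounded_blocks_def)

lemma finite_assignments [simp]: "finite (assignments n)"
  by (simp add: finite_PiE)

lemma num_sat_CNF: "int (num_sat (CNF n bs)) = (\<Sum>\<alpha>\<in>assignments n. of_bool (sat_blocks \<alpha> bs))"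
proof -
  have "{\<alpha> \<in> assignments n. sat_blocks \<alpha> bs} = assignments n \<inter> {\<alpha>. sat_blocks \<alpha> bs}" by auto
  then show ?thesis
    by (simp add: num_sat_def sat_blocks_def case_prod_unfold)
qed

text \<open>The new variables of a gadget have the highest numbers, so this identity sums them out
  one by one, from the top.\<close>

lemma sum_assignments_Suc:
  fixes g :: "(nat \<Rightarrow> bool) \<Rightarrow> int"
  shows "sum g (assignments (Suc n)) = (\<Sum>\<alpha>\<in>assignments n. g (\<alpha>(n := False)) + g (\<alpha>(n := True)))"
proof -
  have "sum g (assignments (Suc n)) = sum (g \<circ> (\<lambda>(y, \<alpha>). \<alpha>(n := y))) (UNIV \<times> assignments n)"
    unfolding lessThan_Suc PiE_insert_eq
    by (rule sum.reindex) (rule inj_combinator, simp)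
  also have "\<dots> = (\<Sum>y\<in>UNIV. \<Sum>\<alpha>\<in>assignments n. g (\<alpha>(n := y)))"
    by (simp add: sum.cartesian_product case_prod_unfold)
  finally show ?thesis
    by (simp add: UNIV_bool sum.distrib)
qed

lemma fst_neg_literal [simp]: "fst (neg_literal l) = fst l"
  by (cases l) auto

lemma snd_neg_literal [simp]: "snd (neg_literal l) = (\<not> snd l)"
  by (cases l) auto

section \<open>Gadgets and signed sums\<close>

lemma bounded_gadget: "\<forall>l \<in> set c. fst l < n \<Longrightarrow> n \<le> k \<Longrightarrow> bounded_blocks (k + 6) (gadget k c)"
  by (fastforce simp: gadget_def bounded_blocks_def)

lemma bounded_gadgets: "bounded_blocks n cs \<Longrightarrow> bounded_blocks (Suc (n + length cs * 5)) (gadgets n cs)"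
proof (induction cs)
  case (Cons c cs)
  then have "bounded_blocks (n + length cs * 5 + 6) (gadget (n + length cs * 5) c)"
    by (intro bounded_gadget[of _ n]) auto
  moreover have "bounded_blocks (Suc (n + length cs * 5)) (gadgets n cs)"
    using Cons by simp
  ultimately show ?case
    by (fastforce simp: bounded_blocks_def)
qed simp

text \<open>Every gadget clause is an implication from one auxiliary variable, so the condition
  splits into one part for each of \<open>a\<close>, \<open>b\<close>, \<open>c'\<close>,
  \<open>d\<close>. The updates only affect variables above \<open>k\<close>, hence neither the new
  sign \<open>\<alpha> k\<close> nor the clause \<open>c\<close>.\<close>

lemma sat_gadget:
  assumes "\<forall>l \<in> set c. fst l < n" "n \<le> k"
  shows "sat_blocks (\<alpha>(Suc k := a, Suc (Suc k) := b, Suc (Suc (Suc k)) := c', Suc (Suc (Suc (Suc k))) := d,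
      Suc (Suc (Suc (Suc (Suc k)))) := s)) (gadget k c) \<longleftrightarrow>
    (a \<longrightarrow> \<not> s \<and> \<not> \<alpha> k) \<and> (b \<longrightarrow> s \<and> \<not> \<alpha> k \<and> \<not> sat_blocks \<alpha> [c]) \<and>
    (c' \<longrightarrow> s \<and> \<alpha> k) \<and> (d \<longrightarrow> \<not> s \<and> \<alpha> k \<and> \<not> sat_blocks \<alpha> [c])"
    (is "sat_blocks ?\<beta> _ \<longleftrightarrow> _")
proof -
  define q where "q = sat_blocks \<alpha> [c]"
  have "sat_blocks ?\<beta> [c] = q"
    unfolding q_def using assms by (intro sat_blocks_cong[of n]) auto
  moreover have "sat_blocks \<alpha>' (concat (map (\<lambda>l. [[(x, False), neg_literal l],
      [(y, False), neg_literal l]]) c)) \<longleftrightarrow>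
    (\<alpha>' x \<longrightarrow> \<not> sat_blocks \<alpha>' [c]) \<and> (\<alpha>' y \<longrightarrow> \<not> sat_blocks \<alpha>' [c])" for \<alpha>' x y
    by (induction c) auto
  ultimately have *: "sat_blocks ?\<beta> (concat (map (\<lambda>l. [[(k + 2, False), neg_literal l],
      [(k + 4, False), neg_literal l]]) c)) \<longleftrightarrow> (b \<longrightarrow> \<not> q) \<and> (d \<longrightarrow> \<not> q)"
    by (simp only:) (simp add: numeral_eq_Suc)
  show ?thesis
    unfolding gadget_def sat_blocks_simps(3) * q_def[symmetric]
    by (cases a; cases b; cases c'; cases d; simp add: numeral_eq_Suc; blast)
qed

text \<open>The old sign \<open>s\<close> is fixed and the final sign gives the weight, as in a
  product of transfer matrices applied to (1, -1). The predicate \<open>P\<close> on the input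
  variables is kept general because the recursion restricts it to the assignments that violate a
  clause.\<close>

definition signed_sum :: "nat \<Rightarrow> literal list list \<Rightarrow> bool \<Rightarrow> ((nat \<Rightarrow> bool) \<Rightarrow> bool) \<Rightarrow> int" where
  "signed_sum n cs s P = (\<Sum>\<alpha>\<in>assignments (Suc (n + length cs * 5)).
     of_bool (P \<alpha> \<and> sat_blocks \<alpha> (gadgets n cs) \<and> \<alpha> (n + length cs * 5) = s) * (if \<alpha> n then - 1 else 1))"

text \<open>This is row \<open>s\<close> of the transfer matrix of \<open>c\<close>: 2 on the
  diagonal, and off it 1 plus the indicator that \<open>c\<close> is violated. The new sign
  \<open>\<alpha> k\<close> is the initial sign of the remaining chain.\<close>

lemma signed_sum_Cons:
  assumes P: "\<And>\<alpha> \<beta>. (\<And>v. v < n \<Longrightarrow> \<alpha> v = \<beta> v) \<Longrightarrow> P \<alpha> = P \<beta>"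
    and c: "\<forall>l \<in> set c. fst l < n" and cs: "bounded_blocks n cs"
  shows "signed_sum n (c # cs) s P = 2 * signed_sum n cs s P + signed_sum n cs (\<not> s) P +
    signed_sum n cs (\<not> s) (\<lambda>\<alpha>. P \<alpha> \<and> \<not> sat_blocks \<alpha> [c])"
proof -
  define k where "k = n + length cs * 5"
  have k: "n + length (c # cs) * 5 = Suc (Suc (Suc (Suc (Suc k))))" by (simp add: k_def)
  define g where "g = (\<lambda>\<alpha>. of_bool (P \<alpha> \<and> sat_blocks \<alpha> (gadgets n (c # cs)) \<and>
    \<alpha> (Suc (Suc (Suc (Suc (Suc k))))) = s) * (if \<alpha> n then - 1 else 1 :: int))"
  have g: "g (\<alpha>(Suc k := a, Suc (Suc k) := b, Suc (Suc (Suc k)) := c',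
    Suc (Suc (Suc (Suc k))) := d, Suc (Suc (Suc (Suc (Suc k)))) := s')) =
      of_bool (s' = s \<and> P \<alpha> \<and> sat_blocks \<alpha> (gadgets n cs) \<and>
        (a \<longrightarrow> \<not> s \<and> \<not> \<alpha> k) \<and> (b \<longrightarrow> s \<and> \<not> \<alpha> k \<and> \<not> sat_blocks \<alpha> [c]) \<and>
        (c' \<longrightarrow> s \<and> \<alpha> k) \<and> (d \<longrightarrow> \<not> s \<and> \<alpha> k \<and> \<not> sat_blocks \<alpha> [c])) * (if \<alpha> n then - 1 else 1)"
    (is "g ?\<beta> = _") for \<alpha> a b c' d s'
  proof -
    have eq: "?\<beta> v = \<alpha> v" if "v < Suc k" for v using that by simp
    have "P ?\<beta> = P \<alpha>" by (rule P) (simp add: k_def)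
    moreover have "sat_blocks ?\<beta> (gadgets n cs) = sat_blocks \<alpha> (gadgets n cs)"
      using bounded_gadgets[OF cs] eq unfolding k_def[symmetric] by (rule sat_blocks_cong)
    moreover have "?\<beta> n = \<alpha> n" by (rule eq) (simp add: k_def)
    moreover have "n \<le> k" by (simp add: k_def)
    note sat_gadget[OF c this, of \<alpha> a b c' d s']
    moreover have "?\<beta> (Suc (Suc (Suc (Suc (Suc k))))) = s'" by simp
    ultimately show ?thesis
      unfolding g_def gadgets.simps sat_blocks_simps(3) k_def[symmetric]
      by (intro arg_cong2[of _ _ _ _ "(*)"] arg_cong[of _ _ of_bool]) auto
  qed
  have "signed_sum n (c # cs) s P = sum g (assignments (Suc (Suc (Suc (Suc (Suc (Suc k)))))))"
    unfolding signed_sum_def k g_def ..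
  also have "\<dots> = (\<Sum>\<alpha>\<in>assignments (Suc k).
      2 * (of_bool (P \<alpha> \<and> sat_blocks \<alpha> (gadgets n cs) \<and> \<alpha> k = s) * (if \<alpha> n then - 1 else 1)) +
      of_bool (P \<alpha> \<and> sat_blocks \<alpha> (gadgets n cs) \<and> \<alpha> k = (\<not> s)) * (if \<alpha> n then - 1 else 1) +
      of_bool ((P \<alpha> \<and> \<not> sat_blocks \<alpha> [c]) \<and> sat_blocks \<alpha> (gadgets n cs) \<and> \<alpha> k = (\<not> s)) *
        (if \<alpha> n then - 1 else 1))"
    unfolding sum_assignments_Suc[of _ "Suc (Suc (Suc (Suc (Suc k))))"]
      sum_assignments_Suc[of _ "Suc (Suc (Suc (Suc k)))"]
      sum_assignments_Suc[of _ "Suc (Suc (Suc k))"] sum_assignments_Suc[of _ "Suc (Suc k)"]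
      sum_assignments_Suc[of _ "Suc k"] g
    \<comment> \<open>For fixed \<open>\<alpha>\<close> the sum runs over the 32 values of the five
      top variables. Once both signs and the truth of \<open>c\<close> are known, it is a count of
      solutions.\<close>
    apply (rule sum.cong[OF refl])
    subgoal for \<alpha>
      by (cases s; cases "\<alpha> k"; cases "sat_blocks \<alpha> [c]"; simp del: sat_blocks_simps)
    done
  also have "\<dots> = 2 * signed_sum n cs s P + signed_sum n cs (\<not> s) P +
      signed_sum n cs (\<not> s) (\<lambda>\<alpha>. P \<alpha> \<and> \<not> sat_blocks \<alpha> [c])"
    unfolding signed_sum_def k_def[symmetric] by (simp only: sum.distrib sum_distrib_left)
  finally show ?thesis .
qed

text \<open>The eigenvector property of (1, -1): for plus, with \<open>X\<close>, \<open>Y\<close>,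
  \<open>Z\<close> counting all assignments that satisfy \<open>P\<close> and \<open>cs\<close>,
  those among them that satisfy \<open>c\<close>, and those that violate it, the row gives 2X - X -
  Z = Y. For minus all signs flip.\<close>

lemma signed_sum_eq:
  assumes "\<And>\<alpha> \<beta>. (\<And>v. v < n \<Longrightarrow> \<alpha> v = \<beta> v) \<Longrightarrow> P \<alpha> = P \<beta>" "bounded_blocks n cs"
  shows "signed_sum n cs s P =
    (if s then - 1 else 1) * (\<Sum>\<alpha>\<in>assignments n. of_bool (P \<alpha> \<and> sat_blocks \<alpha> cs))"
  using assms
proof (induction cs arbitrary: s P)
  case Nil
  have "P (\<alpha>(n := b)) = P \<alpha>" for \<alpha> b by (rule Nil) simp
  then show ?case
    unfolding signed_sum_def sum_distrib_left list.size mult_0 add_0_right sum_assignments_Suc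
    by (intro sum.cong) auto
next
  case (Cons c cs)
  let ?Q = "\<lambda>\<alpha>. P \<alpha> \<and> \<not> sat_blocks \<alpha> [c]"
  have c: "\<forall>l \<in> set c. fst l < n" "bounded_blocks n cs" using Cons.prems(2) by simp_all
  have Q: "?Q \<alpha> = ?Q \<beta>" if "\<And>v. v < n \<Longrightarrow> \<alpha> v = \<beta> v" for \<alpha> \<beta>
    using Cons.prems(1)[OF that] sat_blocks_cong[of n "[c]" \<alpha> \<beta>] c that by simp
  define X Y Z :: int where X: "X = (\<Sum>\<alpha>\<in>assignments n. of_bool (P \<alpha> \<and> sat_blocks \<alpha> cs))"
    and Y: "Y = (\<Sum>\<alpha>\<in>assignments n. of_bool (P \<alpha> \<and> sat_blocks \<alpha> (c # cs)))"
    and Z: "Z = (\<Sum>\<alpha>\<in>assignments n. of_bool (?Q \<alpha> \<and> sat_blocks \<alpha> cs))"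
  have "X = Y + Z"
    unfolding X Y Z sum.distrib[symmetric] by (intro sum.cong) auto
  moreover have "signed_sum n (c # cs) s P = 2 * signed_sum n cs s P + signed_sum n cs (\<not> s) P +
      signed_sum n cs (\<not> s) ?Q"
    by (rule signed_sum_Cons) (use Cons.prems(1) c in blast)+
  moreover have "signed_sum n cs b P = (if b then - 1 else 1) * X" for b
    unfolding X by (rule Cons.IH) (use Cons.prems(1) c(2) in blast)+
  moreover have "signed_sum n cs b ?Q = (if b then - 1 else 1) * Z" for b
    unfolding Z by (rule Cons.IH) (use Q c(2) in blast)+
  ultimately show ?case
    unfolding Y[symmetric] by simp
qed

lemma num_sat_signed_blocks:
  assumes "bounded_blocks n cs"
  shows "int (num_sat (CNF n cs)) =
    int (num_sat (CNF (Suc (n + length cs * 5)) (signed_blocks n False cs))) -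
    int (num_sat (CNF (Suc (n + length cs * 5)) (signed_blocks n True cs)))"
proof -
  have "int (num_sat (CNF n cs)) = signed_sum n cs False (\<lambda>_. True)"
    using signed_sum_eq[of n "\<lambda>_. True" cs False] assms by (simp add: num_sat_CNF)
  also have "\<dots> = int (num_sat (CNF (Suc (n + length cs * 5)) (signed_blocks n False cs))) -
      int (num_sat (CNF (Suc (n + length cs * 5)) (signed_blocks n True cs)))"
    unfolding num_sat_CNF signed_sum_def sum_subtractf[symmetric]
    by (intro sum.cong) (auto simp: signed_blocks_def)
  finally show ?thesis .
qed

section \<open>Bounding the occurrences\<close>

lemma sat_copies:
  assumes "\<And>j v. j \<le> length bs \<Longrightarrow> v < V \<Longrightarrow> \<beta> (j * V + v) = \<alpha> v" "bounded_blocks V bs"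
  shows "sat_blocks \<beta> (copies V bs) = sat_blocks \<alpha> bs"
  using assms
proof (induction bs)
  case (Cons b bs)
  have "\<beta> (Suc (length bs) * V + fst l) = \<alpha> (fst l)" if "l \<in> set b" for l
    by (rule Cons.prems) (use Cons.prems(2) that in auto)
  then have "(\<exists>l \<in> set b. \<beta> (Suc (length bs) * V + fst l) = snd l) = (\<exists>l \<in> set b. \<alpha> (fst l) = snd l)"
    by auto
  moreover have "sat_blocks \<beta> (copies V bs) = sat_blocks \<alpha> bs"
    by (rule Cons.IH) (use Cons.prems in auto)
  ultimately show ?case
    by (simp add: case_prod_unfold)
qed simp

lemma sat_links: "sat_blocks \<beta> (links V m) \<longleftrightarrow> (\<forall>i < m * V. \<beta> (i + V) \<longrightarrow> \<beta> i)"
  by (auto simp: links_def sat_blocks_def)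

lemma sat_closing_links: "sat_blocks \<beta> (closing_links V m) \<longleftrightarrow> (\<forall>v < V. \<beta> v \<longrightarrow> \<beta> (m * V + v))"
  by (auto simp: closing_links_def sat_blocks_def)

text \<open>The links lead down from copy \<open>j\<close> to copy 0; the closing link leads from
  copy 0 to copy \<open>m\<close>, and the links from there down to copy \<open>j\<close>. Around
  the cycle all values agree.\<close>

lemma sat_cycle:
  assumes "sat_blocks \<beta> (links V m)" "sat_blocks \<beta> (closing_links V m)" "j \<le> m" "v < V"
  shows "\<beta> (j * V + v) = \<beta> v"
proof -
  have step: "\<beta> (j * V + v) \<Longrightarrow> \<beta> (i * V + v)" if "i \<le> j" "j \<le> m" for i j
    using that
  proof (induction j rule: dec_induct)
    case (step j)
    have "j * V + v < Suc j * V" using assms(4) by simp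
    also have "\<dots> \<le> m * V" using step.prems by (intro mult_le_mono1) simp
    finally have "\<beta> (j * V + v + V) \<longrightarrow> \<beta> (j * V + v)"
      using assms(1) by (simp add: sat_links)
    then show ?case using step by (simp add: add_ac)
  qed
  have "\<beta> v \<longrightarrow> \<beta> (m * V + v)"
    using assms(2,4) by (simp add: sat_closing_links)
  then show ?thesis
    using step[of 0 j] step[of j m] assms(3) by auto
qed

text \<open>Solutions correspond bijectively: an assignment extends periodically with period
  \<open>V\<close>, and restriction to copy 0 is the inverse, since in a solution all copies
  agree.\<close>

lemma num_sat_split_blocks:
  assumes "bounded_blocks V bs"
  shows "num_sat (CNF (V + length bs * V) (split_blocks V bs)) = num_sat (CNF V bs)"
proof -
  let ?m = "length bs"
  let ?W = "V + ?m * V"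
  let ?f = "\<lambda>\<alpha>. \<lambda>x \<in> {..<?W}. \<alpha> (x mod V) :: bool"
  let ?g = "\<lambda>\<beta>. restrict \<beta> {..<V} :: nat \<Rightarrow> bool"
  have W: "j * V + v < ?W" if "j \<le> ?m" "v < V" for j v
    using that mult_le_mono1[of j ?m V] by linarith
  have f: "?f \<alpha> (j * V + v) = \<alpha> v" if "j \<le> ?m" "v < V" for \<alpha> j v
    using W[OF that] that by simp
  have "bij_betw ?f {\<alpha> \<in> assignments V. sat_blocks \<alpha> bs}
    {\<beta> \<in> assignments ?W. sat_blocks \<beta> (split_blocks V bs)}"
  proof (rule bij_betw_byWitness[of _ ?g])
    show "\<forall>\<alpha>\<in>{\<alpha> \<in> assignments V. sat_blocks \<alpha> bs}. ?g (?f \<alpha>) = \<alpha>"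
      by (auto simp: PiE_def extensional_def fun_eq_iff)
    show "\<forall>\<beta>\<in>{\<beta> \<in> assignments ?W. sat_blocks \<beta> (split_blocks V bs)}. ?f (?g \<beta>) = \<beta>"
    proof safe
      fix \<beta> assume \<beta>: "\<beta> \<in> assignments ?W" "sat_blocks \<beta> (split_blocks V bs)"
      show "?f (?g \<beta>) = \<beta>"
      proof
        fix x
        show "?f (?g \<beta>) x = \<beta> x"
        proof (cases "x < ?W")
          case True
          then have "V > 0" by (cases V) auto
          have "x div V \<le> ?m"
            using True \<open>V > 0\<close> by (simp add: less_Suc_eq_le[symmetric] div_less_iff_less_mult)
          \<comment> \<open>Index \<open>x\<close> is the copy number \<open>x div V\<close> of
            variable \<open>x mod V\<close>.\<close>
          then have "\<beta> (x div V * V + x mod V) = \<beta> (x mod V)"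
            using \<beta>(2) \<open>V > 0\<close> by (intro sat_cycle[of _ V ?m]) (auto simp: split_blocks_def)
          then show ?thesis using True \<open>V > 0\<close> by simp
        next
          case False
          then show ?thesis using \<beta>(1) by (simp add: PiE_def extensional_def)
        qed
      qed
    qed
    show "?f ` {\<alpha> \<in> assignments V. sat_blocks \<alpha> bs} \<subseteq>
        {\<beta> \<in> assignments ?W. sat_blocks \<beta> (split_blocks V bs)}"
    proof (clarify)
      fix \<alpha> assume \<alpha>: "sat_blocks \<alpha> bs"
      have "sat_blocks (?f \<alpha>) (copies V bs)"
        using \<alpha> sat_copies[of bs V "?f \<alpha>" \<alpha>, OF f assms] by simp
      moreover have "sat_blocks (?f \<alpha>) (links V ?m)"
        unfolding sat_links by auto
      moreover have "?f \<alpha> (?m * V + v) = ?f \<alpha> v" if "v < V" for v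
        using f[of ?m v \<alpha>] f[of 0 v \<alpha>] that by simp
      then have "sat_blocks (?f \<alpha>) (closing_links V ?m)"
        unfolding sat_closing_links by blast
      ultimately show "?f \<alpha> \<in> assignments ?W \<and> sat_blocks (?f \<alpha>) (split_blocks V bs)"
        by (auto simp: split_blocks_def)
    qed
    show "?g ` {\<beta> \<in> assignments ?W. sat_blocks \<beta> (split_blocks V bs)} \<subseteq>
        {\<alpha> \<in> assignments V. sat_blocks \<alpha> bs}"
    proof (clarify)
      fix \<beta> assume \<beta>: "sat_blocks \<beta> (split_blocks V bs)"
      have "\<beta> (j * V + v) = ?g \<beta> v" if "j \<le> ?m" "v < V" for j v
        using sat_cycle[of \<beta> V ?m j v] \<beta> that by (simp add: split_blocks_def)
      then have "sat_blocks \<beta> (copies V bs) = sat_blocks (?g \<beta>) bs"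
        using assms by (rule sat_copies)
      then show "?g \<beta> \<in> assignments V \<and> sat_blocks (?g \<beta>) bs"
        using \<beta> by (auto simp: split_blocks_def)
    qed
  qed
  then show ?thesis
    by (simp add: num_sat_def sat_blocks_def case_prod_unfold bij_betw_same_card)
qed

section \<open>Occurrences and normal form of the split formula\<close>

text \<open>Division by \<open>V\<close> recovers the copy index, which identifies the block a
  variable comes from. Nonemptiness is carried along because empty blocks of different copies would
  coincide; distinct variables in a block give one occurrence per copy.\<close>

lemma copies_props:
  assumes "b \<in> set (copies V bs)" "bounded_blocks V bs"
    "\<forall>b \<in> set bs. b \<noteq> [] \<and> length b \<le> 2 \<and> distinct (map fst b)"
  shows "b \<noteq> [] \<and> length b \<le> 2 \<and> distinct (map fst b) \<and>
    (\<exists>j. 0 < j \<and> j \<le> length bs \<and> (\<forall>l \<in> set b. fst l div V = j))"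
  using assms
proof (induction bs)
  case (Cons c bs)
  show ?case
  proof (cases "b \<in> set (copies V bs)")
    case True
    then show ?thesis using Cons by (fastforce intro: le_SucI)
  next
    case False
    then have b: "b = map (\<lambda>(v, s). (Suc (length bs) * V + v, s)) c"
      using Cons.prems(1) by simp
    have "fst l div V = Suc (length bs)" if "l \<in> set b" for l
      using that Cons.prems(2) unfolding b by (auto simp del: mult_Suc)
    moreover have "map fst b = map (\<lambda>v. Suc (length bs) * V + v) (map fst c)"
      unfolding b by auto
    then have "distinct (map fst b)"
      using Cons.prems(3) by (simp only: distinct_map) (auto simp: inj_on_def)
    ultimately show ?thesis using Cons.prems(3) unfolding b by auto
  qed
qed simp

definition num_occurrences :: "nat \<Rightarrow> literal list list \<Rightarrow> nat" where
  "num_occurrences x bs = length (filter (\<lambda>l. fst l = x) (concat bs))"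

lemma num_occurrences_simps [simp]:
  "num_occurrences x [] = 0"
  "num_occurrences x (b # bs) = length (filter (\<lambda>l. fst l = x) b) + num_occurrences x bs"
  "num_occurrences x (bs @ bs') = num_occurrences x bs + num_occurrences x bs'"
  by (auto simp: num_occurrences_def)

lemma num_occurrences_eq_0: "x \<notin> fst ` set (concat bs) \<Longrightarrow> num_occurrences x bs = 0"
  unfolding num_occurrences_def by (auto simp: filter_empty_conv)

lemma length_filter_fst_le_1:
  assumes "distinct (map fst b)"
  shows "length (filter (\<lambda>l. fst l = x) b) \<le> 1"
  using assms
proof (induction b)
  case (Cons l b)
  have "filter (\<lambda>l'. fst l' = x) b = []" if "fst l = x"
    using Cons.prems that by (auto simp: filter_empty_conv image_iff)
  then show ?case using Cons by (cases "fst l = x") auto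
qed simp

text \<open>Only one block can use the copy \<open>x div V\<close> in which \<open>x\<close> lies,
  and it mentions \<open>x\<close> at most once.\<close>

lemma num_occurrences_copies:
  assumes "bounded_blocks V bs"
    "\<forall>b \<in> set bs. b \<noteq> [] \<and> length b \<le> 2 \<and> distinct (map fst b)"
  shows "num_occurrences x (copies V bs) \<le> 1"
  using assms
proof (induction bs)
  case (Cons c bs)
  let ?b = "map (\<lambda>(v, s). (Suc (length bs) * V + v, s)) c"
  have b: "\<forall>l \<in> set ?b. fst l div V = Suc (length bs)"
    using Cons.prems(1) by (auto simp del: mult_Suc)
  have "distinct (map fst ?b)"
    using copies_props[OF _ Cons.prems, of ?b] by simp
  then have 1: "length (filter (\<lambda>l. fst l = x) ?b) \<le> 1"
    by (rule length_filter_fst_le_1)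
  show ?case
  proof (cases "x div V = Suc (length bs)")
    case True
    have "\<exists>j \<le> length bs. \<forall>l \<in> set b'. fst l div V = j" if "b' \<in> set (copies V bs)" for b'
      using copies_props[OF that] Cons.prems by auto
    then have "num_occurrences x (copies V bs) = 0"
      using True by (intro num_occurrences_eq_0) fastforce
    then show ?thesis using 1 by simp
  next
    case False
    then have "filter (\<lambda>l. fst l = x) ?b = []"
      using b by (auto simp: filter_empty_conv)
    then show ?thesis using Cons by simp
  qed
qed simp

lemma num_occurrences_map_pairs:
  "num_occurrences x (map (\<lambda>i. [(f i, False), (g i, True)]) (rev [0..<m])) =
    card {i. i < m \<and> f i = x} + card {i. i < m \<and> g i = x}"
proof -
  have "num_occurrences x (map (\<lambda>i. [(f i, False), (g i, True)]) is) =
      length (filter (\<lambda>i. f i = x) is) + length (filter (\<lambda>i. g i = x) is)" for "is"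
    by (induction "is") auto
  moreover have "length (filter P (rev [0..<m])) = card {i. i < m \<and> P i}" for P
    unfolding rev_filter[symmetric] length_rev length_filter_conv_card
    by (rule arg_cong[of _ _ card]) auto
  ultimately show ?thesis by simp
qed

lemma num_occurrences_split_blocks:
  assumes "bounded_blocks V bs"
    "\<forall>b \<in> set bs. b \<noteq> [] \<and> length b \<le> 2 \<and> distinct (map fst b)"
  shows "num_occurrences x (split_blocks V bs) \<le> 3"
proof -
  let ?m = "length bs"
  \<comment> \<open>The first two sets are the negative occurrences of \<open>x\<close>, the last
    two the positive ones. The first requires \<open>V \<le> x\<close> and the second
    \<open>x < V\<close>; the third requires \<open>x < ?m * V\<close> and the fourth the opposite.
    So each pair contributes at most one.\<close>
  have "{i. i < ?m * V \<and> i + V = x} = (if V \<le> x \<and> x - V < ?m * V then {x - V} else {})"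
    "{v. v < V \<and> v = x} = (if x < V then {x} else {})"
    "{i. i < ?m * V \<and> i = x} = (if x < ?m * V then {x} else {})"
    "{v. v < V \<and> ?m * V + v = x} = (if ?m * V \<le> x \<and> x - ?m * V < V then {x - ?m * V} else {})"
    by auto
  then have "num_occurrences x (links V ?m) + num_occurrences x (closing_links V ?m) \<le> 2"
    unfolding links_def closing_links_def num_occurrences_map_pairs by simp
  then show ?thesis
    using num_occurrences_copies[OF assms, of x] by (simp add: split_blocks_def)
qed

text \<open>Nonempty blocks with different copy indices are different sets, so the copies are
  distinct even where blocks of \<open>bs\<close> repeat.\<close>

lemma distinct_copies:
  assumes "bounded_blocks V bs"
    "\<forall>b \<in> set bs. b \<noteq> [] \<and> length b \<le> 2 \<and> distinct (map fst b)"
  shows "distinct (map set (copies V bs))"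
  using assms
proof (induction bs)
  case (Cons c bs)
  let ?b = "map (\<lambda>(v, s). (Suc (length bs) * V + v, s)) c"
  have ne: "?b \<noteq> []" using Cons.prems by simp
  have b: "\<forall>l \<in> set ?b. fst l div V = Suc (length bs)"
    using Cons.prems(1) by (auto simp del: mult_Suc)
  have "set ?b \<noteq> set b'" if b': "b' \<in> set (copies V bs)" for b'
  proof
    assume *: "set ?b = set b'"
    obtain j where "j \<le> length bs" "\<forall>l \<in> set b'. fst l div V = j"
      using copies_props[OF b'] Cons.prems by auto
    moreover obtain l where "l \<in> set ?b" using ne by fastforce
    ultimately show False using b * by fastforce
  qed
  then have "set ?b \<notin> set ` set (copies V bs)" by blast
  then show ?case using Cons by simp
qed simp

text \<open>Copy indices keep the three kinds of blocks apart: a copied block stays inside one copy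
  of positive index, a link joins two consecutive copies, and a closing link has its negative
  literal in copy 0, where a link never has it.\<close>

lemma d_CNF_split_blocks:
  assumes bs: "bounded_blocks V bs"
    "\<forall>b \<in> set bs. b \<noteq> [] \<and> length b \<le> 2 \<and> distinct (map fst b)"
    and m: "length bs \<ge> 2" and V: "V > 0"
  shows "d_CNF 2 (CNF (V + length bs * V) (split_blocks V bs))"
proof -
  let ?m = "length bs"
  let ?W = "V + ?m * V"
  have m': "V \<le> ?m * V" using m by (cases ?m) auto
  have c: "b \<noteq> [] \<and> length b \<le> 2 \<and> distinct b \<and> (\<forall>l \<in> set b. fst l < ?W) \<and>
      (\<exists>j. 0 < j \<and> (\<forall>l \<in> set b. fst l div V = j))"
    if b: "b \<in> set (copies V bs)" for b
  proof -
    have p: "b \<noteq> []" "length b \<le> 2" "distinct (map fst b)"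
      using copies_props[OF b bs] by auto
    obtain j where j: "0 < j" "j \<le> ?m" "\<forall>l \<in> set b. fst l div V = j"
      using copies_props[OF b bs] by auto
    have "fst l < ?W" if "l \<in> set b" for l
    proof -
      have "fst l div V < Suc ?m" using j that by simp
      then have "fst l < Suc ?m * V" using V by (simp only: div_less_iff_less_mult)
      then show ?thesis by simp
    qed
    then show ?thesis using p j(1,3) by (auto simp: distinct_map)
  qed
  have "set b \<noteq> {(i + V, False), (i, True)}" if b: "b \<in> set (copies V bs)" for b i
  proof
    assume *: "set b = {(i + V, False), (i, True)}"
    obtain j where "\<forall>l \<in> set b. fst l div V = j" using c[OF b] by blast
    then have "(i + V) div V = i div V" using * by simp
    then show False using V by simp
  qed
  moreover have "set b \<noteq> {(v, False), (?m * V + v, True)}" if b: "b \<in> set (copies V bs)" and v: "v < V" for b v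
  proof
    assume *: "set b = {(v, False), (?m * V + v, True)}"
    obtain j where "0 < j" "\<forall>l \<in> set b. fst l div V = j" using c[OF b] by blast
    then have "v div V > 0" using * by simp
    then show False using v by simp
  qed
  moreover have "{(i + V, False), (i, True)} \<noteq> {(v, False), (?m * V + v, True)}" if "v < V" for i v
    using that by (auto simp: doubleton_eq_iff)
  moreover have "distinct (map set (links V ?m))"
    by (auto simp: links_def distinct_map inj_on_def doubleton_eq_iff)
  moreover have "distinct (map set (closing_links V ?m))"
    by (auto simp: closing_links_def distinct_map inj_on_def doubleton_eq_iff)
  ultimately have "distinct (map set (split_blocks V bs))"
    using distinct_copies[OF bs]
    by (auto simp: split_blocks_def links_def closing_links_def image_iff)
  moreover have "length b \<le> 2 \<and> distinct b \<and> (\<forall>l \<in> set b. fst l < ?W)"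
    if "b \<in> set (split_blocks V bs)" for b
    using that c m' by (auto simp: split_blocks_def links_def closing_links_def)
  ultimately show ?thesis
    by (fastforce simp: d_CNF_def well_formed_def)
qed

text \<open>A gadget clause joins an auxiliary variable, numbered above \<open>n\<close>, to a sign
  bit or to an input variable, numbered below \<open>n\<close>. It thus has two different variables,
  even if the input clause is empty or repeats a variable.\<close>

lemma signed_blocks_props:
  assumes "bounded_blocks n cs"
  shows "bounded_blocks (Suc (n + length cs * 5)) (signed_blocks n b cs)"
    and "\<forall>b \<in> set (signed_blocks n s cs). b \<noteq> [] \<and> length b \<le> 2 \<and> distinct (map fst b)"
proof -
  show "bounded_blocks (Suc (n + length cs * 5)) (signed_blocks n b cs)"
    using bounded_gadgets[OF assms] by (simp add: signed_blocks_def)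
  have "b \<noteq> [] \<and> length b \<le> 2 \<and> distinct (map fst b)"
    if "b \<in> set (gadget k c)" "\<forall>l \<in> set c. fst l < n" "n \<le> k" for b k c
    using that by (fastforce simp: gadget_def)
  then have "\<forall>b \<in> set (gadgets n cs). b \<noteq> [] \<and> length b \<le> 2 \<and> distinct (map fst b)"
    using assms by (induction cs) fastforce+
  then show "\<forall>b \<in> set (signed_blocks n s cs). b \<noteq> [] \<and> length b \<le> 2 \<and> distinct (map fst b)"
    by (simp add: signed_blocks_def)
qed

lemma is_CNF_signed_formula [simp]: "is_CNF (signed_formula b \<gamma>)"
  by (simp add: signed_formula_def Let_def)

lemma nvars_signed_formula: "nvars (signed_formula True \<gamma>) = nvars (signed_formula False \<gamma>)"
  by (simp add: signed_formula_def Let_def signed_blocks_def)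

lemma d_CNF_bounded_blocks: "d_CNF d \<gamma> \<Longrightarrow> bounded_blocks (nvars \<gamma>) (blocks \<gamma>)"
  by (fastforce simp: d_CNF_def well_formed_def bounded_blocks_def)

lemma signed_formula_correct:
  assumes "d_CNF d \<gamma>"
  shows "d_CNF 2 (signed_formula b \<gamma>)"
    and "occurrences v (signed_formula b \<gamma>) \<le> 3"
    and "int (num_sat \<gamma>) =
      int (num_sat (signed_formula False \<gamma>)) - int (num_sat (signed_formula True \<gamma>))"
proof -
  have bb: "bounded_blocks (nvars \<gamma>) (blocks \<gamma>)" using assms by (rule d_CNF_bounded_blocks)
  note props = signed_blocks_props[OF bb]
  show "d_CNF 2 (signed_formula b \<gamma>)"
    unfolding signed_formula_def Let_def
    by (rule d_CNF_split_blocks[OF props]) (simp_all add: signed_blocks_def)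
  show "occurrences v (signed_formula b \<gamma>) \<le> 3"
    using num_occurrences_split_blocks[OF props, of v]
    by (simp add: signed_formula_def Let_def occurrences_def num_occurrences_def)
  have "\<gamma> = CNF (nvars \<gamma>) (blocks \<gamma>)"
    using assms by (cases \<gamma>) (auto simp: d_CNF_def)
  then show "int (num_sat \<gamma>) =
      int (num_sat (signed_formula False \<gamma>)) - int (num_sat (signed_formula True \<gamma>))"
    unfolding signed_formula_def Let_def num_sat_split_blocks[OF props(1)]
    using num_sat_signed_blocks[OF bb] by simp
qed

section \<open>Complementation to DNF\<close>

lemma num_sat_dual:
  assumes "is_CNF \<phi>"
  shows "int (num_sat (dual \<phi>)) = 2 ^ nvars \<phi> - int (num_sat \<phi>)"
proof -
  obtain n bs where \<phi>: "\<phi> = CNF n bs" using assms by (cases \<phi>) auto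
  have "sat \<alpha> (dual \<phi>) \<longleftrightarrow> \<not> sat \<alpha> \<phi>" for \<alpha>
    by (simp add: \<phi> dual_def case_prod_unfold)
  then have "{\<alpha> \<in> assignments n. sat \<alpha> (dual \<phi>)} = assignments n - {\<alpha> \<in> assignments n. sat \<alpha> \<phi>}"
    by auto
  moreover have "card (assignments n) = 2 ^ n"
    by (simp add: card_PiE)
  moreover have "card {\<alpha> \<in> assignments n. sat \<alpha> \<phi>} \<le> card (assignments n)"
    by (intro card_mono) auto
  ultimately show ?thesis
    by (simp add: num_sat_def card_Diff_subset \<phi> dual_def of_nat_diff)
qed

lemma inj_neg_literal: "inj neg_literal"
  by (auto simp: inj_def)

lemma d_DNF_dual:
  assumes "d_CNF d \<phi>"
  shows "d_DNF d (dual \<phi>)"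
proof -
  have "inj_on neg_literal A" for A using inj_neg_literal by (rule inj_on_subset) simp
  moreover have "distinct (map set (map (map neg_literal) bs))" if "distinct (map set bs)" for bs
  proof -
    have "map set (map (map neg_literal) bs) = map ((`) neg_literal) (map set bs)" by simp
    moreover have "inj ((`) neg_literal)" using inj_neg_literal by (simp add: inj_def inj_image_eq_iff)
    ultimately show ?thesis using that
      by (simp only: distinct_map[of "(`) neg_literal"]) (auto intro: inj_on_subset)
  qed
  ultimately show ?thesis
    using assms by (fastforce simp: d_CNF_def d_DNF_def well_formed_def dual_def distinct_map)
qed

lemma occurrences_dual: "occurrences v (dual \<phi>) = occurrences v \<phi>"
proof -
  have "concat (map (map neg_literal) bs) = map neg_literal (concat bs)" for bs
    by (simp add: map_concat)
  then show ?thesis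
    by (simp add: occurrences_def dual_def filter_map comp_def)
qed

theorem corollary26:
  fixes d :: nat
  assumes "d \<ge> 2"
  shows "\<forall>two_NF \<in> {d_CNF 2, d_DNF 2}.
    \<exists>(prog :: com) (p :: nat poly). \<forall>(k :: nat) \<ge> 1. \<forall>(\<gamma> :: formula) (n :: nat).
      d_CNF d \<gamma> \<and> nvars \<gamma> = n \<longrightarrow>
      (\<exists>(t :: nat) (\<gamma>1 :: nat \<Rightarrow> formula) (\<gamma>2 :: nat \<Rightarrow> formula).
        computes_within prog
          (enc_pair enc_nat enc_formula (k, \<gamma>))
          (enc_list (enc_pair enc_formula enc_formula) (map (\<lambda>i. (\<gamma>1 i, \<gamma>2 i)) [1..<t + 1]))
          (t * poly p n) \<and>
        int (num_sat \<gamma>) = (\<Sum>i = 1..t. int (num_sat (\<gamma>1 i)) - int (num_sat (\<gamma>2 i))) \<and>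
        real t \<le> 2 powr (real n / real k) \<and>
        (\<forall>i \<in> {1..t}. \<forall>\<phi> \<in> {\<gamma>1 i, \<gamma>2 i}.
          two_NF \<phi> \<and> (\<forall>v < nvars \<phi>. occurrences v \<phi> \<le> 3)))"
proof (rule ballI, goal_cases)
  case (1 two_NF)
  \<comment> \<open>\<open>F\<close> acts on trees and \<open>G\<close> on formulas;
    \<open>G False\<close> is the formula that is added and \<open>G True\<close> the one that is
    subtracted. From here on both normal forms are treated alike.\<close>
  obtain F G where pt: "\<And>b. ptime (F b)"
    and enc: "\<And>b \<gamma>. F b (enc_formula \<gamma>) = enc_formula (G b \<gamma>)"
    and diff: "\<And>\<gamma>. d_CNF d \<gamma> \<Longrightarrow>
      int (num_sat \<gamma>) = int (num_sat (G False \<gamma>)) - int (num_sat (G True \<gamma>))"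
    and nf: "\<And>b \<gamma> v. d_CNF d \<gamma> \<Longrightarrow> two_NF (G b \<gamma>) \<and> occurrences v (G b \<gamma>) \<le> 3"
  proof (cases "two_NF = d_CNF 2")
    case True
    show ?thesis
      by (rule that[of "\<lambda>b. signed_formula_tree (enc_bool b)" signed_formula,
            OF ptime_signed_formula_tree signed_formula_tree_enc signed_formula_correct(3)])
        (simp_all add: True signed_formula_correct(1,2))
  next
    case False
    with 1 have dnf: "two_NF = d_DNF 2" by simp
    show ?thesis
    proof (rule that[of "\<lambda>b x. dual_tree (signed_formula_tree (enc_bool (\<not> b)) x)"
          "\<lambda>b \<gamma>. dual (signed_formula (\<not> b) \<gamma>)"])
      show "ptime (\<lambda>x. dual_tree (signed_formula_tree (enc_bool (\<not> b)) x))" for b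
        by (rule ptime_comp[OF ptime_dual_tree ptime_signed_formula_tree])
      show "int (num_sat \<gamma>) = int (num_sat (dual (signed_formula (\<not> False) \<gamma>))) -
          int (num_sat (dual (signed_formula (\<not> True) \<gamma>)))" if "d_CNF d \<gamma>" for \<gamma>
        using signed_formula_correct(3)[OF that] by (simp add: num_sat_dual nvars_signed_formula)
    qed (simp_all add: dnf signed_formula_tree_enc dual_tree_enc d_DNF_dual occurrences_dual
        signed_formula_correct(1,2))
  qed
  \<comment> \<open>A \<open>Node\<close> whose right part is \<open>Leaf\<close> encodes a
    one-element list, here the output for \<open>t = 1\<close>.\<close>
  have "ptime (\<lambda>x. Node (Node (F False x) (F True x)) Leaf)"
    using pt by (intro ptime_intros)
  from ptime_imp_computes_within[OF this, of d] obtain prog p where prog: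
    "\<And>k \<gamma>. d_CNF d \<gamma> \<Longrightarrow> computes_within prog (enc_pair enc_nat enc_formula (k, \<gamma>))
      (Node (Node (enc_formula (G False \<gamma>)) (enc_formula (G True \<gamma>))) Leaf) (poly p (nvars \<gamma>))"
    unfolding enc by blast
  show ?case
  proof (intro exI[of _ prog] exI[of _ p] allI impI, goal_cases)
    case (1 k \<gamma> n)
    then show ?case
      using prog[of \<gamma> k] diff[of \<gamma>] nf[of \<gamma>]
      by (intro exI[of _ 1] exI[of _ "\<lambda>_. G False \<gamma>"] exI[of _ "\<lambda>_. G True \<gamma>"])
        (auto simp: enc_pair_def ge_one_powr_ge_zero)
  qed
qed

end
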